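(* Let $E\subset\mathbb{R}^2$ be a closed, bounded set with smooth boundary which is weakly $1$-semiconvex and is not $1$-semiconvex. Then $E$ consists of at least four components.
   Context: In the plane, a $1$-dimensional half-plane is a ray (closed half-line). A set $E\subset\mathbb{R}^2$ is called $1$-semiconvex with respect to a point $x\in\mathbb{R}^2\setminus E$ if there exists a ray $L$ such that $x\in L$ and $L\cap E=\emptyset$ (equivalently, there is a ray starting at $x$ that does not meet $E$). A set $E\subset\mathbb{R}^2$ is called $1$-semiconvex if it is $1$-semiconvex with respect to every point $x\in\mathbb{R}^2\setminus E$. An open set $G\subset\mathbb{R}^2$ is called weakly $1$-semiconvex if it is $1$-semiconvex with respect to every point $x\in\partial G$, where $\partial G=\overline{G}\setminus\mathrm{Int}\,G$. A set $A$ is approximated from the outside by a family of open sets $A_k$, $k=1,2,\ldots$, if $\overline{A}_{k+1}\subset A_k$ for all $k$ and $A=\bigcap_k A_k$. A closed set $E\subset\mathbb{R}^2$ is called weakly $1$-semiconvex if it can be approximated from the outside by a family of open weakly $1$-semiconvex sets. The components of a nonempty set are its maximal connected subsets. "Smooth boundary" is understood in the standard sense. *)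

theory Defs
  imports "HOL-Analysis.Analysis"
begin

definition is_ray :: "(real^2) set \<Rightarrow> bool" where
  "is_ray L \<longleftrightarrow> (\<exists>a d. d \<noteq> 0 \<and> L = {a + t *\<^sub>R d | t. t \<ge> 0})"

definition semiconvex_wrt :: "(real^2) set \<Rightarrow> real^2 \<Rightarrow> bool" where
  "semiconvex_wrt E x \<longleftrightarrow> (\<exists>L. is_ray L \<and> x \<in> L \<and> L \<inter> E = {})"

definition semiconvex :: "(real^2) set \<Rightarrow> bool" where
  "semiconvex E \<longleftrightarrow> (\<forall>x. x \<notin> E \<longrightarrow> semiconvex_wrt E x)"

definition weakly_semiconvex_open :: "(real^2) set \<Rightarrow> bool" where
  "weakly_semiconvex_open G \<longleftrightarrow> open G \<and> (\<forall>x\<in>frontier G. semiconvex_wrt G x)"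

definition approximated_from_outside :: "(real^2) set \<Rightarrow> (nat \<Rightarrow> (real^2) set) \<Rightarrow> bool" where
  "approximated_from_outside E A \<longleftrightarrow>
     (\<forall>k. open (A k)) \<and> (\<forall>k. closure (A (Suc k)) \<subseteq> A k) \<and> E = (\<Inter>k. A k)"

definition weakly_semiconvex_closed :: "(real^2) set \<Rightarrow> bool" where
  "weakly_semiconvex_closed E \<longleftrightarrow>
     closed E \<and> (\<exists>A. approximated_from_outside E A \<and> (\<forall>k. weakly_semiconvex_open (A k)))"

text \<open>The boundary is an embedded \<open>C\<^sup>1\<close> submanifold of dimension 1: near each of its points it is
  the zero set of a continuously differentiable function \<open>f\<close> whose gradient \<open>g\<close> vanishes nowhere.
  Only \<open>C\<^sup>1\<close> is required, and the set need not lie locally on one side of its boundary, so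
  \<open>C\<^sup>\<infinity>\<close> boundaries and closed domains with smooth boundary are special cases.\<close>

definition smooth_boundary :: "(real^2) set \<Rightarrow> bool" where
  "smooth_boundary E \<longleftrightarrow>
     (\<forall>p\<in>frontier E. \<exists>U (f :: real^2 \<Rightarrow> real) g.
        open U \<and> p \<in> U \<and>
        (\<forall>x\<in>U. GDERIV f x :> g x) \<and> continuous_on U g \<and> (\<forall>x\<in>U. g x \<noteq> 0) \<and>
        frontier E \<inter> U = {x \<in> U. f x = 0})"

end

theory Submission
  imports Defs
begin

text \<open>Let \<open>x \<notin> E\<close> be a point all of whose rays meet \<open>E\<close>; move it to the origin. Towards every direction
  \<open>\<phi>\<close>, just before the first point of \<open>E\<close>, there is a frontier point of an approximating open set, and
  the ray it owns avoids \<open>E\<close>. It is not radial, so together with the radial segment it forms a bent path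
  from \<open>x\<close> to infinity that turns counterclockwise or clockwise by less than \<open>\<pi>\<close>. In the universal cover
  of the plane without \<open>x\<close>, such a path separates the lifts of the components of \<open>E\<close>; of two lifts that
  overlap in angle and lie on different sides of the path, the one on the near side is in front.
  If a component, seen from \<open>x\<close>, is in front at one of its angular ends, then by smoothness its boundary
  is tangent to the line of sight there, and the path towards that end has to turn away from the component.
  For a minimal set of at most three components blocking all rays from \<open>x\<close>, these facts about paths and
  fronts are contradictory by a combinatorial argument on the line of angles.\<close>

section \<open>Chains of arcs on the line of angles\<close>

text \<open>Neighbouring lifts need not be comparable: one may be nearer at some common angles and
  farther at others. A comparison holds only where a path separates the two lifts, so comparisons
  have to be extracted from paths. Conversely, a comparison makes an end of an arc a tip, and the
  tip yields a path turning in a prescribed sense. This feedback produces comparisons of both kinds,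
  \<open>FR\<close> and \<open>BR\<close>. In a cycle of length two or three they are adjacent, so
  some component is in front of both its neighbours or, with three components, behind both. Each
  case is refuted by paths in test directions at distance \<open>pi\<close> from the ends of arcs,
  since a path turns by less than \<open>pi\<close>.

  Lifts are used instead of components because two components can be neighbours on both sides, with
  different comparisons. Minimality of the blocking family makes only consecutive lifts overlap. One
  branch of the argument serves all components at once: any single bent path is a slit from the
  origin to infinity.\<close>

text \<open>\<open>{a k..b k}\<close> is the angular interval of the \<open>k\<close>-th lifted component, \<open>n\<close> the number of components
  and \<open>\<rho> k \<theta>\<close> the distance of the \<open>k\<close>-th lift from the origin in direction \<open>\<theta>\<close>.\<close>

locale angular_chain =
  fixes n :: int and a b :: "int \<Rightarrow> real" and \<rho> :: "int \<Rightarrow> real \<Rightarrow> real"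
  assumes n23: "n = 2 \<or> n = 3"
    and a_period: "a (k + n) = a k + 2 * pi"
    and b_period: "b (k + n) = b k + 2 * pi"
    and \<rho>_period: "\<rho> (k + n) (\<theta> + 2 * pi) = \<rho> k \<theta>"
    and overlap: "a (k + 1) \<le> b k"
    and gap: "b k < a (k + 2)"
begin

text \<open>A path that starts in direction \<open>\<phi>\<close> and escapes to infinity in direction \<open>\<mu>\<close> cuts the lifts into
  those beyond it (the index set) and those on the side of the origin.\<close>

definition ccw_cut :: "real \<Rightarrow> real \<Rightarrow> int set \<Rightarrow> bool" where
  "ccw_cut \<phi> \<mu> L \<longleftrightarrow> \<phi> < \<mu> \<and> \<mu> < \<phi> + pi \<and> (\<forall>k\<in>L. b k < \<mu>) \<and> (\<forall>k. k \<notin> L \<longrightarrow> \<phi> < a k) \<and>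
     (\<forall>k\<in>L. \<forall>j. j \<notin> L \<longrightarrow> (\<forall>\<theta>\<in>{a k..b k} \<inter> {a j..b j}. \<rho> j \<theta> < \<rho> k \<theta>))"

definition cw_cut :: "real \<Rightarrow> real \<Rightarrow> int set \<Rightarrow> bool" where
  "cw_cut \<phi> \<mu> R \<longleftrightarrow> \<phi> - pi < \<mu> \<and> \<mu> < \<phi> \<and> (\<forall>k\<in>R. \<mu> < a k) \<and> (\<forall>k. k \<notin> R \<longrightarrow> b k < \<phi>) \<and>
     (\<forall>k\<in>R. \<forall>j. j \<notin> R \<longrightarrow> (\<forall>\<theta>\<in>{a k..b k} \<inter> {a j..b j}. \<rho> j \<theta> < \<rho> k \<theta>))"

definition ccw :: "real \<Rightarrow> bool" where "ccw \<phi> \<longleftrightarrow> (\<exists>\<mu> L. ccw_cut \<phi> \<mu> L)"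

definition cw :: "real \<Rightarrow> bool" where "cw \<phi> \<longleftrightarrow> (\<exists>\<mu> R. cw_cut \<phi> \<mu> R)"

text \<open>\<open>FR k\<close>: lift \<open>k\<close> is in front of its right neighbour; \<open>BR k\<close>: it is behind its right neighbour.\<close>

definition FR :: "int \<Rightarrow> bool" where
  "FR k \<longleftrightarrow> (\<forall>\<theta>\<in>{a (k + 1)..b k}. \<rho> k \<theta> < \<rho> (k + 1) \<theta>)"

definition BR :: "int \<Rightarrow> bool" where
  "BR k \<longleftrightarrow> (\<forall>\<theta>\<in>{a (k + 1)..b k}. \<rho> (k + 1) \<theta> < \<rho> k \<theta>)"

section \<open>Order, periodicity and unboundedness of the lifted arcs\<close>

lemma a_less: "a k < a (k + 1)"
proof -
  have "a k \<le> b (k - 1)" using overlap[of "k - 1"] by simp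
  also have "\<dots> < a (k + 1)" using gap[of "k - 1"] by (simp add: algebra_simps)
  finally show ?thesis .
qed

lemma b_less: "b k < b (k + 1)"
  using gap[of k] overlap[of "k + 1"] by (simp add: algebra_simps)

lemma strict_mono_a: "strict_mono a"
proof (rule strict_monoI)
  fix i j :: int assume "i < j"
  then show "a i < a j"
    by (induction j rule: int_gr_induct) (use a_less order.strict_trans in blast)+
qed

lemma strict_mono_b: "strict_mono b"
proof (rule strict_monoI)
  fix i j :: int assume "i < j"
  then show "b i < b j"
    by (induction j rule: int_gr_induct) (use b_less order.strict_trans in blast)+
qed

lemma a_mono: "i \<le> j \<Longrightarrow> a i \<le> a j" and b_mono: "i \<le> j \<Longrightarrow> b i \<le> b j"
  using strict_mono_a strict_mono_b by (simp_all add: strict_mono_less_eq)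

lemma not_FR_BR: "FR k \<Longrightarrow> \<not> BR k"
  using overlap[of k] unfolding FR_def BR_def by (meson atLeastAtMost_iff less_asym order_refl)

lemma shift_iff: "\<theta> \<in> {a (k + n + 1)..b (k + n)} \<longleftrightarrow> \<theta> - 2 * pi \<in> {a (k + 1)..b k}"
  using a_period[of "k + 1"] b_period[of k] by (auto simp: algebra_simps)

lemma \<rho>_shift: "\<rho> (k + n) \<theta> = \<rho> k (\<theta> - 2 * pi)"
  using \<rho>_period[of k "\<theta> - 2 * pi"] by simp

lemma FR_period: "FR (k + n) \<longleftrightarrow> FR k"
proof -
  have "FR (k + n) \<longleftrightarrow> (\<forall>\<theta>. \<theta> - 2 * pi \<in> {a (k + 1)..b k} \<longrightarrow> \<rho> k (\<theta> - 2 * pi) < \<rho> (k + 1) (\<theta> - 2 * pi))"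
    unfolding FR_def Ball_def shift_iff \<rho>_shift using \<rho>_shift[of "k + 1"] by (simp add: ac_simps)
  also have "\<dots> \<longleftrightarrow> FR k"
    unfolding FR_def by (metis add_diff_cancel)
  finally show ?thesis .
qed

lemma FR_period_mult: "FR (k + n * int m) \<longleftrightarrow> FR k"
proof (induction m)
  case (Suc m)
  have "k + n * int (Suc m) = (k + n * int m) + n" by (simp add: algebra_simps)
  then show ?case using FR_period Suc by metis
qed simp

lemma a_period_mult: "a (k + n * int m) = a k + 2 * pi * m"
proof (induction m)
  case (Suc m)
  have "k + n * int (Suc m) = (k + n * int m) + n" by (simp add: algebra_simps)
  then have "a (k + n * int (Suc m)) = a (k + n * int m) + 2 * pi" using a_period by metis
  then show ?case using Suc by (simp add: algebra_simps)
qed simp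

lemma a_unbounded: "\<exists>m. a (k + int m) > r"
proof -
  obtain m :: nat where "(r - a k) / (2 * pi) < m" using reals_Archimedean2 by blast
  then have "r < a k + 2 * pi * m" by (simp add: field_simps)
  moreover have "n * int m = int (nat n * m)" "0 \<le> n" using n23 by auto
  ultimately show ?thesis using a_period_mult[of k m] by (intro exI[of _ "nat n * m"]) simp
qed

lemma b_unbounded_below: "\<exists>m. b (k - int m) < r"
proof -
  obtain m :: nat where m: "(b k - r) / (2 * pi) < m" using reals_Archimedean2 by blast
  have shift: "b (k - n * int m) = b k - 2 * pi * m" for m
  proof (induction m)
    case (Suc m)
    have "k - n * int m = (k - n * int (Suc m)) + n" by (simp add: algebra_simps)
    then have "b (k - n * int m) = b (k - n * int (Suc m)) + 2 * pi" using b_period by metis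
    then show ?case using Suc by (simp add: algebra_simps)
  qed simp
  have "b k - 2 * pi * m < r" using m by (simp add: field_simps)
  moreover have "n * int m = int (nat n * m)" "0 \<le> n" using n23 by auto
  ultimately show ?thesis using shift[of m] by (intro exI[of _ "nat n * m"]) simp
qed

text \<open>The index set of the cut contains \<open>i\<close>, but not all later lifts, since their
  arcs pass \<open>\<mu>\<close>. Where it is left for the first time, consecutive lifts lie on
  different sides of the path, and the cut compares exactly these two. The bound
  \<open>b k < \<phi> + pi\<close> is what survives of the turning angle.\<close>

lemma ccw_imp_BR:
  assumes "ccw \<phi>" and i: "\<phi> \<in> {a i..b i}"
  shows "\<exists>k\<ge>i. BR k \<and> b k < \<phi> + pi"
proof -
  obtain \<mu> L where cut: "ccw_cut \<phi> \<mu> L" using assms(1) unfolding ccw_def by blast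
  then have \<mu>: "\<mu> < \<phi> + pi" and L: "\<And>k. k \<in> L \<Longrightarrow> b k < \<mu>" "\<And>k. k \<notin> L \<Longrightarrow> \<phi> < a k"
    unfolding ccw_cut_def by simp_all
  have front: "\<rho> j \<theta> < \<rho> k \<theta>" if "k \<in> L" "j \<notin> L" "\<theta> \<in> {a k..b k}" "\<theta> \<in> {a j..b j}" for k j \<theta>
    using cut that unfolding ccw_cut_def by blast
  have iL: "i \<in> L" using L(2) i by force
  obtain m where m: "a (i + int m) > \<mu>" using a_unbounded by blast
  have "i + int m \<notin> L"
    using L(1)[of "i + int m"] m overlap[of "i + int m"] a_less[of "i + int m"] by force
  then have ex: "\<exists>m. i + int m \<notin> L" by blast
  define l where "l = (LEAST m. i + int m \<notin> L)"
  have l: "i + int l \<notin> L" unfolding l_def using ex by (rule LeastI_ex)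
  have "l \<noteq> 0" using l iL by (metis add.right_neutral of_nat_0)
  then obtain l' where l': "l = Suc l'" using not0_implies_Suc by blast
  define k where "k = i + int l'"
  have kL: "k \<in> L" unfolding k_def using not_less_Least[of l' "\<lambda>m. i + int m \<notin> L"] l' l_def by auto
  have k1: "k + 1 \<notin> L" using l l' by (simp add: k_def ac_simps)
  have "BR k" unfolding BR_def
  proof
    fix \<theta> assume t: "\<theta> \<in> {a (k + 1)..b k}"
    show "\<rho> (k + 1) \<theta> < \<rho> k \<theta>"
      by (rule front[OF kL k1]) (use t a_less[of k] b_less[of k] in auto)
  qed
  then show ?thesis using L(1)[OF kL] \<mu> by (intro exI[of _ k]) (auto simp: k_def)
qed

text \<open>Mirror image of the counterclockwise case, with the index running down from
  \<open>i\<close>. The pair at the exit is \<open>k - 1\<close>, \<open>k\<close>, so the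
  comparison carries the index \<open>k - 1\<close> while the bound concerns
  \<open>a k\<close>.\<close>

lemma cw_imp_FR:
  assumes "cw \<phi>" and i: "\<phi> \<in> {a i..b i}"
  shows "\<exists>k\<le>i. FR (k - 1) \<and> \<phi> - pi < a k"
proof -
  obtain \<mu> R where cut: "cw_cut \<phi> \<mu> R" using assms(1) unfolding cw_def by blast
  then have \<mu>: "\<phi> - pi < \<mu>" and R: "\<And>k. k \<in> R \<Longrightarrow> \<mu> < a k" "\<And>k. k \<notin> R \<Longrightarrow> b k < \<phi>"
    unfolding cw_cut_def by simp_all
  have front: "\<rho> j \<theta> < \<rho> k \<theta>" if "k \<in> R" "j \<notin> R" "\<theta> \<in> {a k..b k}" "\<theta> \<in> {a j..b j}" for k j \<theta>
    using cut that unfolding cw_cut_def by blast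
  have iR: "i \<in> R" using R(2) i by force
  obtain m where m: "b (i - int m) < \<mu>" using b_unbounded_below by blast
  have "i - int m \<notin> R"
    using R(1)[of "i - int m"] m overlap[of "i - int m"] a_less[of "i - int m"] by force
  then have ex: "\<exists>m. i - int m \<notin> R" by blast
  define l where "l = (LEAST m. i - int m \<notin> R)"
  have l: "i - int l \<notin> R" unfolding l_def using ex by (rule LeastI_ex)
  have "l \<noteq> 0" using l iR by (metis diff_zero of_nat_0)
  then obtain l' where l': "l = Suc l'" using not0_implies_Suc by blast
  define k where "k = i - int l'"
  have kR: "k \<in> R" unfolding k_def using not_less_Least[of l' "\<lambda>m. i - int m \<notin> R"] l' l_def by auto
  have k1: "k - 1 \<notin> R" using l l' by (simp add: k_def algebra_simps)
  have "FR (k - 1)" unfolding FR_def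
  proof
    fix \<theta> assume t: "\<theta> \<in> {a (k - 1 + 1)..b (k - 1)}"
    have "\<rho> (k - 1) \<theta> < \<rho> k \<theta>"
      by (rule front[OF kR k1]) (use t a_less[of "k - 1"] b_less[of "k - 1"] in auto)
    then show "\<rho> (k - 1) \<theta> < \<rho> (k - 1 + 1) \<theta>" by simp
  qed
  then show ?thesis using R(1)[OF kR] \<mu> by (intro exI[of _ k]) (auto simp: k_def)
qed

text \<open>The two components other than the loser \<open>m\<close> are \<open>i\<close> and \<open>j\<close>. A counterclockwise path starting on them
  either passes over \<open>m\<close>, hence turns beyond \<open>a i + 2 * pi\<close>, or shows that \<open>j\<close> is in front of \<open>i\<close>.\<close>

lemma not_loses_both:
  assumes n: "n = 3"
    and cuts: "\<And>\<phi>. ccw \<phi> \<or> cw \<phi>"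
    and tip_ccw: "\<And>k. FR k \<Longrightarrow> ccw (b k)" and tip_cw: "\<And>k. BR k \<Longrightarrow> cw (a (k + 1))"
    and m: "FR (m - 1)" "BR m"
  shows False
proof -
  define i j where "i = m + 1" and "j = m + 2"
  have ij: "j = i + 1" by (simp add: i_def j_def)
  have FRj: "FR j" using FR_period[of "m - 1"] m(1) n by (simp add: j_def ac_simps)
  have BRi: "BR (i - 1)" using m(2) by (simp add: i_def)
  have aj: "a (j + 2) = a i + 2 * pi" using a_period[of i] n by (simp add: i_def j_def ac_simps)
  have bj: "b (i - 2) = b j - 2 * pi" using b_period[of "i - 2"] n by (simp add: i_def j_def ac_simps)
  \<comment> \<open>The arcs \<open>i\<close> and \<open>j\<close> together span less than a full
    turn. Hence no direction lies both after \<open>a i + pi\<close> and before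
    \<open>b j - pi\<close>, the two thresholds on which everything below turns.\<close>
  have len: "b j - pi < a i + pi" using gap[of j] aj by simp
  have ov: "a j \<le> b i" using overlap[of i] by (simp add: ij)
  \<comment> \<open>A path passing over the loser's lift \<open>j + 1\<close> has to clear the end
    of that arc, which is not before \<open>a (j + 2) = a i + 2 * pi\<close>.\<close>
  have far_ccw: "\<phi> > a i + pi" if "k \<ge> j + 1" "b k < \<phi> + pi" for k \<phi>
    using b_mono[OF that(1)] that(2) overlap[of "j + 1"] aj by (simp add: ac_simps)
  have far_cw: "\<phi> < b j - pi" if "k \<le> i - 1" "\<phi> - pi < a k" for k \<phi>
    using a_mono[OF that(1)] that(2) overlap[of "i - 2"] bj by (simp add: ac_simps)
  have c1: "\<phi> > a i + pi" if h: "\<phi> \<in> {a j..b j}" "ccw \<phi>" for \<phi>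
  proof -
    obtain k where k: "k \<ge> j" "BR k" "b k < \<phi> + pi" using ccw_imp_BR[OF h(2,1)] by blast
    have "k \<noteq> j" using k not_FR_BR FRj by blast
    then show ?thesis using far_ccw[of k \<phi>] k by simp
  qed
  have c2: "\<phi> < b j - pi" if h: "\<phi> \<in> {a i..b i}" "cw \<phi>" for \<phi>
  proof -
    obtain k where k: "k \<le> i" "FR (k - 1)" "\<phi> - pi < a k" using cw_imp_FR[OF h(2,1)] by blast
    have "k \<noteq> i" using k not_FR_BR BRi by blast
    then show ?thesis using far_cw[of k \<phi>] k by simp
  qed
  have ai_aj: "a i < a j" and bi_bj: "b i < b j" using a_less[of i] b_less[of i] by (simp_all add: ij)
  have c3: "\<phi> > a i + pi \<or> a j < b j - pi" if h: "\<phi> \<in> {a i..b i}" "ccw \<phi>" for \<phi>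
  proof -
    obtain k where k: "k \<ge> i" "BR k" "b k < \<phi> + pi" using ccw_imp_BR[OF h(2,1)] by blast
    have "k \<noteq> j" using k not_FR_BR FRj by blast
    then consider "k = i" | "k \<ge> j + 1" using k(1) ij by linarith
    then show ?thesis
    proof cases
      case 1
      \<comment> \<open>Now \<open>j\<close> is in front of \<open>i\<close>, so the start of arc
        \<open>j\<close> is a tip. It still lies in arc \<open>i\<close>, hence its clockwise path
        is subject to \<open>c2\<close>.\<close>
      then have "cw (a j)" using tip_cw k ij by blast
      then show ?thesis using c2[of "a j"] ov ai_aj by auto
    next
      case 2
      then show ?thesis using far_ccw k by blast
    qed
  qed
  have c4: "\<phi> < b j - pi \<or> b i > a i + pi" if h: "\<phi> \<in> {a j..b j}" "cw \<phi>" for \<phi>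
  proof -
    obtain k where k: "k \<le> j" "FR (k - 1)" "\<phi> - pi < a k" using cw_imp_FR[OF h(2,1)] by blast
    have "k \<noteq> i" using k not_FR_BR BRi by blast
    then consider "k = j" | "k \<le> i - 1" using k(1) ij by linarith
    then show ?thesis
    proof cases
      case 1
      then have "ccw (b i)" using tip_ccw[of i] k ij by simp
      then show ?thesis using c1[of "b i"] ov bi_bj by auto
    next
      case 2
      then show ?thesis using far_cw k by blast
    qed
  qed
  \<comment> \<open>In the first two cases a threshold itself is a direction of just one of the
    arcs, and the strict bounds fail there. In the third case a direction common to both arcs lies
    between the thresholds, where \<open>c1\<close> excludes counterclockwise and \<open>c2\<close>
    clockwise paths.\<close>
  consider "a j > a i + pi" | "b i < b j - pi" | "a j \<le> a i + pi" "b i \<ge> b j - pi" by linarith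
  then show False
  proof cases
    case 1
    have "a i + pi \<in> {a i..b i}" using 1 ov by auto
    then show False using cuts[of "a i + pi"] c2[of "a i + pi"] c3[of "a i + pi"] 1 len by fastforce
  next
    case 2
    have "b j - pi \<in> {a j..b j}" using 2 ov by auto
    then show False using cuts[of "b j - pi"] c1[of "b j - pi"] c4[of "b j - pi"] 2 len by fastforce
  next
    case 3
    define \<phi> where "\<phi> = max (a j) (b j - pi)"
    have "\<phi> \<in> {a i..b i}" "\<phi> \<in> {a j..b j}" "b j - pi \<le> \<phi>" "\<phi> \<le> a i + pi"
      using 3 ov ai_aj bi_bj len by (auto simp: \<phi>_def)
    then show False using cuts[of \<phi>] c1[of \<phi>] c2[of \<phi>] by fastforce
  qed
qed

text \<open>A path starting on arc \<open>i\<close> cannot separate \<open>i\<close> from the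
  neighbour on the side to which it turns, so it uses a comparison farther away. Either this makes
  another component lose on both sides, or the path reaches almost once around. The choice
  \<open>\<phi> = min (a i + pi) (b i)\<close> forbids the latter for both senses of
  turning.\<close>

lemma not_wins_both:
  assumes cuts: "\<And>\<phi>. ccw \<phi> \<or> cw \<phi>"
    and tip_ccw: "\<And>k. FR k \<Longrightarrow> ccw (b k)" and tip_cw: "\<And>k. BR k \<Longrightarrow> cw (a (k + 1))"
    and i: "BR (i - 1)" "FR i"
  shows False
proof -
  define \<phi> where "\<phi> = min (a i + pi) (b i)"
  have ab: "a i \<le> b i" using overlap[of i] a_less[of i] by simp
  have \<phi>: "\<phi> \<in> {a i..b i}" using ab by (auto simp: \<phi>_def)
  have short: "b i < a i + 2 * pi"
    using gap[of i] a_period[of i] n23 a_mono[of "i + 2" "i + n"] by auto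
  show False
  proof (cases "ccw \<phi>")
    case True
    then obtain k where k: "k \<ge> i" "BR k" "b k < \<phi> + pi" using ccw_imp_BR \<phi> by blast
    have "k \<noteq> i" using k not_FR_BR i by blast
    have "n = 3 \<and> k = i + 1 \<or> k \<ge> i + n - 1" using \<open>k \<noteq> i\<close> k(1) n23 by auto
    then show False
    proof
      assume "n = 3 \<and> k = i + 1"
      then show False using not_loses_both[OF _ cuts tip_ccw tip_cw, of "i + 1"] i k by simp
    next
      assume "k \<ge> i + n - 1"
      then have "a i + 2 * pi \<le> b k" using b_mono overlap[of "i + n - 1"] a_period[of i] by (force simp: ac_simps)
      then show False using k \<phi>_def by auto
    qed
  next
    case False
    then have "cw \<phi>" using cuts by blast
    then obtain k where k: "k \<le> i" "FR (k - 1)" "\<phi> - pi < a k" using cw_imp_FR \<phi> by blast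
    have "k \<noteq> i" using k not_FR_BR i by blast
    have "n = 3 \<and> k = i - 1 \<or> k \<le> i - n + 1" using \<open>k \<noteq> i\<close> k(1) n23 by auto
    then show False
    proof
      assume "n = 3 \<and> k = i - 1"
      then show False using not_loses_both[OF _ cuts tip_ccw tip_cw, of "i - 1"] i k by simp
    next
      assume "k \<le> i - n + 1"
      then have "a k \<le> b i - 2 * pi" using a_mono overlap[of "i - n"] b_period[of "i - n"] by force
      \<comment> \<open>The bounds give \<open>\<phi> < b i - pi\<close>. This is absurd if
        \<open>\<phi>\<close> is \<open>b i\<close>; if it is \<open>a i + pi\<close>, arc
        \<open>i\<close> would be longer than a full turn.\<close>
      then show False using k(3) short pi_gt_zero unfolding \<phi>_def min_def by (smt (verit))
    qed
  qed
qed

lemma no_cut_system: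
  assumes cuts: "\<And>\<phi>. ccw \<phi> \<or> cw \<phi>"
    and tip_ccw: "\<And>k. FR k \<Longrightarrow> ccw (b k)" and tip_cw: "\<And>k. BR k \<Longrightarrow> cw (a (k + 1))"
  shows False
proof -
  have ab: "a k \<le> b k" for k using overlap[of k] a_less[of k] by simp
  have "\<exists>k. BR k"
  proof (cases "ccw (a 0)")
    case True
    then show ?thesis using ccw_imp_BR[of "a 0" 0] ab by auto
  next
    case False
    then have "cw (a 0)" using cuts by blast
    then obtain k where "FR (k - 1)" using cw_imp_FR[of "a 0" 0] ab by auto
    then have "ccw (b (k - 1))" by (rule tip_ccw)
    then show ?thesis using ccw_imp_BR ab by (metis atLeastAtMost_iff order_refl)
  qed
  then obtain k where k: "BR k" by blast
  then have "cw (a (k + 1))" by (rule tip_cw)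
  moreover have "a (k + 1) \<in> {a k..b k}" using overlap[of k] a_less[of k] by auto
  ultimately obtain j where j: "j \<le> k" "FR (j - 1)" using cw_imp_FR by blast
  define d where "d = nat (k - (j - 1))"
  have jk: "j - 1 = k - int d" using j by (simp add: d_def)
  define l where "l = nat (int d div n)"
  have l: "int l = int d div n" unfolding l_def using n23 by (auto simp: pos_imp_zdiv_nonneg_iff)
  \<comment> \<open>Reduction modulo the period leaves \<open>FR (k - e)\<close> with
    \<open>0 < e < n\<close>. For \<open>e = 1\<close> and three components, \<open>k\<close> loses
    on both sides; \<open>e = n - 1\<close> is \<open>FR (k + 1)\<close> one period later, so
    \<open>k + 1\<close> wins on both sides.\<close>
  define e where "e = int d mod n"
  have "k - e = (j - 1) + n * int l" using jk l by (simp add: e_def minus_mod_eq_mult_div [symmetric])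
  then have FRe: "FR (k - e)" using FR_period_mult j(2) by metis
  have "e \<in> {0, 1, 2}" "e < n" using n23 unfolding e_def by auto
  moreover have "e \<noteq> 0" using FRe k not_FR_BR by force
  ultimately have "n = 3 \<and> e = 1 \<or> e = n - 1" using n23 by auto
  then show False
  proof
    assume "n = 3 \<and> e = 1"
    then show False using not_loses_both[OF _ cuts tip_ccw tip_cw, of k] FRe k by simp
  next
    assume "e = n - 1"
    then have "FR (k + 1)" using FR_period[of "k - e"] FRe by simp
    then show False using not_wins_both[OF cuts tip_ccw tip_cw, of "k + 1"] k by simp
  qed
qed

end

section \<open>The argument function off a bent path\<close>

lemma cis_eq_iff: "cis x = cis y \<longleftrightarrow> (\<exists>k::int. x = y + 2 * pi * of_int k)"
  using sin_cos_eq_iff[of x y] by (auto simp: complex_eq_iff)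

lemma Im_mult_cis: "Im (complex_of_real r * cis t) = r * sin t"
  by simp

text \<open>The quantity \<open>cmod w * sin (\<mu> - G w)\<close> is the signed distance of
  \<open>w\<close> from the line through the origin in direction \<open>\<mu>\<close>; on the ray it
  equals \<open>s * sin \<mu>\<close>. In the sector between 0 and \<open>\<mu>\<close> the values
  of \<open>G\<close> on the two sides of the ray differ by \<open>2 * pi\<close>, hence a range
  longer than a full turn. Values above 0 belong to points beyond the ray, values below
  \<open>\<mu> - 2 * pi\<close> to points on the side of the origin.\<close>

lemma slit_argument:
  fixes s \<mu> :: real
  assumes s: "0 < s" and \<mu>: "0 < \<mu>" "\<mu> < pi"
  defines "P \<equiv> {complex_of_real t | t. 0 \<le> t \<and> t \<le> s} \<union> {of_real s + of_real t * cis \<mu> | t. 0 \<le> t}"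
  obtains G where "continuous_on (- P) G"
    and "\<And>w. w \<notin> P \<Longrightarrow> w = of_real (cmod w) * cis (G w)"
    and "\<And>w. w \<notin> P \<Longrightarrow> - 2 * pi < G w \<and> G w < \<mu>"
    and "\<And>w. w \<notin> P \<Longrightarrow> 0 < G w \<Longrightarrow> cmod w * sin (\<mu> - G w) \<ge> s * sin \<mu>"
    and "\<And>w. w \<notin> P \<Longrightarrow> G w < \<mu> - 2 * pi \<Longrightarrow> cmod w * sin (\<mu> - G w) \<le> s * sin \<mu>"
proof
  \<comment> \<open>Write \<open>w\<close> as \<open>w / (w - s)\<close> times \<open>w - s\<close>: the first factor avoids the nonpositive reals off the
    segment, the second one avoids the direction \<open>\<mu>\<close> off the ray.\<close>
  define X where "X w = Arg (w / (w - of_real s))" for w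
  define Y where "Y w = Arg (- (w - of_real s) * cis (- \<mu>)) + \<mu> - pi" for w
  define G where "G w = X w + Y w" for w
  have nz: "w \<noteq> 0" "w \<noteq> of_real s" if "w \<notin> P" for w
    using that s unfolding P_def by force+
  have nX: "w / (w - of_real s) \<notin> \<real>\<^sub>\<le>\<^sub>0" if w: "w \<notin> P" for w
  proof
    assume "w / (w - of_real s) \<in> \<real>\<^sub>\<le>\<^sub>0"
    then obtain r where r: "r \<le> 0" "w / (w - of_real s) = of_real r"
      by (auto elim!: nonpos_Reals_cases)
    then have "w = of_real r * (w - of_real s)" using nz[OF w] by (simp add: field_simps)
    then have "w * of_real (1 - r) = of_real (- r * s)" by (simp add: algebra_simps)
    then have "w = of_real (- r * s) / of_real (1 - r)" using r(1) by (simp add: field_simps del: of_real_diff of_real_mult)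
    then have "w = of_real (- r * s / (1 - r))" by simp
    moreover have "0 \<le> - r * s / (1 - r)" "- r * s / (1 - r) \<le> s"
      using r(1) s by (auto simp: field_simps mult_nonpos_nonneg)
    ultimately show False using w unfolding P_def by blast
  qed
  have nY: "- (w - of_real s) * cis (- \<mu>) \<notin> \<real>\<^sub>\<le>\<^sub>0" if w: "w \<notin> P" for w
  proof
    assume "- (w - of_real s) * cis (- \<mu>) \<in> \<real>\<^sub>\<le>\<^sub>0"
    then obtain r where r: "r \<le> 0" "- (w - of_real s) * cis (- \<mu>) = of_real r"
      by (auto elim!: nonpos_Reals_cases)
    then have "- (w - of_real s) * cis (- \<mu>) * cis \<mu> = of_real r * cis \<mu>" by simp
    then have "- (w - of_real s) = of_real r * cis \<mu>" by (simp add: mult.assoc cis_mult)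
    then have "w = of_real s + of_real (- r) * cis \<mu>" by (simp add: algebra_simps)
    then show False using w r(1) unfolding P_def by (smt (verit, best) UnI2 mem_Collect_eq)
  qed
  show "continuous_on (- P) G"
    unfolding G_def X_def Y_def using nX nY nz
    by (intro continuous_intros continuous_on_compose2[OF continuous_on_Arg, of "- \<real>\<^sub>\<le>\<^sub>0"]) auto
  have cisY: "cis (Y w) = sgn (w - of_real s)" if w: "w \<notin> P" for w
  proof -
    have "cis (Arg (- (w - of_real s) * cis (- \<mu>))) = sgn (- (w - of_real s) * cis (- \<mu>))"
      using nz[OF w] by (intro cis_Arg) auto
    also have "\<dots> = - sgn (w - of_real s) * cis (- \<mu>)" unfolding sgn_mult sgn_minus by simp
    finally have 1: "cis (Arg (- (w - of_real s) * cis (- \<mu>))) = - sgn (w - of_real s) * cis (- \<mu>)" .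
    have "cis (Y w) = cis (Arg (- (w - of_real s) * cis (- \<mu>))) * cis \<mu> * cis (- pi)"
      unfolding Y_def cis_mult by simp
    also have "\<dots> = sgn (w - of_real s)"
      unfolding 1 by (simp add: mult.assoc cis_mult complex_eq_iff)
    finally show ?thesis .
  qed
  have Yw: "w - of_real s = of_real (cmod (w - of_real s)) * cis (Y w)" if w: "w \<notin> P" for w
    using nz[OF w] cisY[OF w] by (simp add: sgn_div_norm scaleR_conv_of_real)
  have Gw: "w = of_real (cmod w) * cis (G w)" if w: "w \<notin> P" for w
  proof -
    have "cis (G w) = sgn (w / (w - of_real s)) * sgn (w - of_real s)"
      using nz[OF w] unfolding G_def X_def cis_mult[symmetric] cisY[OF w]
      by (subst cis_Arg) auto
    also have "\<dots> = sgn w" unfolding sgn_mult[symmetric] using nz[OF w] by simp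
    finally show ?thesis using nz[OF w] by (simp add: sgn_div_norm scaleR_conv_of_real)
  qed
  then show "\<And>w. w \<notin> P \<Longrightarrow> w = of_real (cmod w) * cis (G w)" .
  have Yrange: "\<mu> - 2 * pi < Y w" "Y w < \<mu>" if w: "w \<notin> P" for w
    using Arg_bounded[of "- (w - of_real s) * cis (- \<mu>)"] nY[OF w] Arg_eq_pi[of "- (w - of_real s) * cis (- \<mu>)"]
    unfolding Y_def by (auto simp: less_le complex_nonpos_Reals_iff)
  have ImX: "Im (w / (w - of_real s)) = - s * Im w / (cmod (w - of_real s))\<^sup>2" for w
    unfolding Im_divide cmod_power2 by (simp add: algebra_simps)
  \<comment> \<open>Up to sign, \<open>X w\<close> is the angle under which the segment from 0 to
    \<open>s\<close> is seen from \<open>w\<close>; its sign is opposite to that of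
    \<open>Im w\<close>.\<close>
  have key: "(Im w > 0 \<longrightarrow> X w \<in> {-pi<..<0}) \<and> (Im w < 0 \<longrightarrow> X w \<in> {0<..<pi}) \<and> (Im w = 0 \<longrightarrow> X w = 0)"
    if w: "w \<notin> P" for w
  proof -
    have pos: "s / (cmod (w - of_real s))\<^sup>2 > 0" using s nz[OF w] by simp
    have "Im w > 0 \<Longrightarrow> Im (w / (w - of_real s)) < 0" "Im w < 0 \<Longrightarrow> Im (w / (w - of_real s)) > 0"
      "Im w = 0 \<Longrightarrow> Im (w / (w - of_real s)) = 0"
      using pos mult_pos_pos[OF pos, of "Im w"] mult_pos_pos[OF pos, of "- Im w"]
      by (auto simp: ImX)
    moreover have "Im (w / (w - of_real s)) = 0 \<Longrightarrow> X w = 0"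
      using nX[OF w] unfolding X_def Arg_eq_0 complex_nonpos_Reals_iff complex_is_Real_iff by linarith
    ultimately show ?thesis
      unfolding X_def using Arg_lt_pi Arg_neg_iff mpi_less_Arg by auto
  qed
  have sinG: "Im w = cmod w * sin (G w)" if "w \<notin> P" for w
    by (subst Gw[OF that]) simp
  have sinY: "Im w = cmod (w - of_real s) * sin (Y w)" if "w \<notin> P" for w
    using arg_cong[OF Yw[OF that], of Im] by simp
  have sin_neg: "sin x \<le> 0" if "- pi \<le> x" "x \<le> 0" for x :: real
    using sin_ge_zero[of "- x"] that by simp
  have G_neg: "- pi < G w \<and> G w < 0" if w: "w \<notin> P" "Im w < 0" for w
  proof -
    have "sin (Y w) < 0" "sin (G w) < 0"
      using sinY[OF w(1)] sinG[OF w(1)] w(2) mult_nonneg_nonneg[OF norm_ge_zero] by (metis not_le)+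
    have "Y w < 0"
      using \<open>sin (Y w) < 0\<close> Yrange[OF w(1)] \<mu> sin_ge_zero[of "Y w"] by linarith
    moreover have "- pi < Y w"
      using \<open>sin (Y w) < 0\<close> Yrange[OF w(1)] \<mu> sin_ge_zero[of "Y w + 2 * pi"] by fastforce
    ultimately have "- pi < G w" "G w < pi" using key[OF w(1)] w(2) unfolding G_def by auto
    then show ?thesis using \<open>sin (G w) < 0\<close> sin_ge_zero[of "G w"] by linarith
  qed
  have G_pos: "- 2 * pi < G w \<and> G w < \<mu>" if w: "w \<notin> P" "Im w > 0" for w
  proof -
    have "sin (Y w) > 0" "sin (G w) > 0"
      using sinY[OF w(1)] sinG[OF w(1)] w(2) mult_nonneg_nonpos[OF norm_ge_zero] by (metis not_le)+
    have X: "- pi < X w" "X w < 0" using key[OF w(1)] w(2) by auto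
    \<comment> \<open>The ranges of \<open>X\<close> and \<open>Y\<close> give only the bound
      \<open>\<mu> - 3 * pi\<close>; the positive sine in the upper half-plane excludes the
      remaining values.\<close>
    have "- 2 * pi < G w"
    proof (rule ccontr)
      assume "\<not> - 2 * pi < G w"
      then have "sin (G w + 2 * pi) \<le> 0"
        using X Yrange[OF w(1)] \<mu> unfolding G_def by (intro sin_neg) auto
      then show False using \<open>sin (G w) > 0\<close> by simp
    qed
    then show ?thesis using X Yrange[OF w(1)] unfolding G_def by auto
  qed
  show range: "- 2 * pi < G w \<and> G w < \<mu>" if w: "w \<notin> P" for w
  proof -
    consider "Im w > 0" | "Im w < 0" | "Im w = 0" by linarith
    then show ?thesis
      using G_pos[OF w] G_neg[OF w] key[OF w] Yrange[OF w] \<mu> by cases (auto simp: G_def)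
  qed
  \<comment> \<open>Multiplication by \<open>cis (- \<mu>)\<close> makes the direction
    \<open>\<mu>\<close> horizontal, and translation by \<open>s\<close> changes the signed distance
    by \<open>s * sin \<mu>\<close>. So the sign of \<open>sin (\<mu> - Y w)\<close> tells the side
    of the ray.\<close>
  have side: "cmod w * sin (\<mu> - G w) = cmod (w - of_real s) * sin (\<mu> - Y w) + s * sin \<mu>" if w: "w \<notin> P" for w
  proof -
    have "- (w * cis (- \<mu>)) = of_real (cmod w) * - cis (G w - \<mu>)"
      by (subst Gw[OF w]) (simp add: mult.assoc cis_mult)
    then have "Im (- (w * cis (- \<mu>))) = Im (of_real (cmod w) * - cis (G w - \<mu>))" by (rule arg_cong)
    also have "\<dots> = cmod w * sin (\<mu> - G w)" by (simp add: sin_diff algebra_simps)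
    finally have 1: "Im (- (w * cis (- \<mu>))) = cmod w * sin (\<mu> - G w)" .
    have "- ((w - of_real s) * cis (- \<mu>)) = of_real (cmod (w - of_real s)) * - cis (Y w - \<mu>)"
      by (subst Yw[OF w]) (simp add: mult.assoc cis_mult)
    then have "Im (- ((w - of_real s) * cis (- \<mu>))) = Im (of_real (cmod (w - of_real s)) * - cis (Y w - \<mu>))"
      by (rule arg_cong)
    also have "\<dots> = cmod (w - of_real s) * sin (\<mu> - Y w)" by (simp add: sin_diff algebra_simps)
    finally have 2: "Im (- ((w - of_real s) * cis (- \<mu>))) = cmod (w - of_real s) * sin (\<mu> - Y w)" .
    show ?thesis unfolding 1[symmetric] 2[symmetric] by (simp add: algebra_simps)
  qed
  have Im_pos: "Im w > 0" if "w \<notin> P" "sin (G w) > 0" for w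
    using sinG[OF that(1)] nz[OF that(1)] that(2) by simp
  show "cmod w * sin (\<mu> - G w) \<ge> s * sin \<mu>" if w: "w \<notin> P" "0 < G w" for w
  proof -
    have "Im w > 0" using w range[OF w(1)] \<mu> by (intro Im_pos sin_gt_zero) auto
    then have "0 < Y w" using key[OF w(1)] w(2) unfolding G_def by auto
    then have "sin (\<mu> - Y w) \<ge> 0" using Yrange[OF w(1)] \<mu> by (intro sin_ge_zero) auto
    then show ?thesis using side[OF w(1)] by simp
  qed
  show "cmod w * sin (\<mu> - G w) \<le> s * sin \<mu>" if w: "w \<notin> P" "G w < \<mu> - 2 * pi" for w
  proof -
    have "sin (G w + 2 * pi) > 0" using w range[OF w(1)] \<mu> by (intro sin_gt_zero) auto
    then have "Im w > 0" using w by (intro Im_pos) auto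
    then have "Y w < \<mu> - pi" using key[OF w(1)] w(2) unfolding G_def by auto
    then have "sin (\<mu> - Y w - 2 * pi) \<le> 0" using Yrange[OF w(1)] \<mu> by (intro sin_neg) auto
    then have "sin (\<mu> - Y w) \<le> 0" by (simp add: sin_diff)
    then show ?thesis using side[OF w(1)] by (simp add: mult_nonneg_nonpos)
  qed
qed

text \<open>After rotation by \<open>- \<phi>\<close>, the branch of the argument off the path and
  the branch \<open>g\<close> differ on \<open>C\<close> by multiples of \<open>2 * pi\<close>, and
  connectedness leaves a single one. The shift by \<open>N\<close> is the last lift of
  \<open>C\<close> beyond the path; the shift by \<open>N + 1\<close> is the first on the side of
  the origin.\<close>

lemma ccw_slit_lift:
  fixes g :: "complex \<Rightarrow> real"
  assumes C: "connected C" and g: "continuous_on C g" "\<And>w. w \<in> C \<Longrightarrow> w = of_real (cmod w) * cis (g w)"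
    and s: "0 < s" and \<mu>: "\<phi> < \<mu>" "\<mu> < \<phi> + pi"
    and seg: "\<And>t. 0 \<le> t \<Longrightarrow> t \<le> s \<Longrightarrow> of_real t * cis \<phi> \<notin> C"
    and ray: "\<And>t. 0 \<le> t \<Longrightarrow> of_real s * cis \<phi> + of_real t * cis \<mu> \<notin> C"
  obtains N :: int where
    "\<And>w. w \<in> C \<Longrightarrow> \<phi> - 2 * pi < g w + 2 * pi * N \<and> g w + 2 * pi * N < \<mu>"
    "\<And>w. w \<in> C \<Longrightarrow> \<phi> < g w + 2 * pi * N \<Longrightarrow>
        s * sin (\<mu> - \<phi>) \<le> cmod w * sin (\<mu> - (g w + 2 * pi * N))"
    "\<And>w. w \<in> C \<Longrightarrow> g w + 2 * pi * N < \<mu> - 2 * pi \<Longrightarrow>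
        cmod w * sin (\<mu> - (g w + 2 * pi * N)) \<le> s * sin (\<mu> - \<phi>)"
proof -
  define P where "P = {complex_of_real t | t. 0 \<le> t \<and> t \<le> s} \<union> {of_real s + of_real t * cis (\<mu> - \<phi>) | t. 0 \<le> t}"
  have "0 < \<mu> - \<phi>" "\<mu> - \<phi> < pi" using \<mu> by auto
  from slit_argument[OF s this] obtain G where G: "continuous_on (- P) G"
    "\<And>w. w \<notin> P \<Longrightarrow> w = of_real (cmod w) * cis (G w)"
    "\<And>w. w \<notin> P \<Longrightarrow> - 2 * pi < G w \<and> G w < \<mu> - \<phi>"
    "\<And>w. w \<notin> P \<Longrightarrow> 0 < G w \<Longrightarrow> cmod w * sin (\<mu> - \<phi> - G w) \<ge> s * sin (\<mu> - \<phi>)"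
    "\<And>w. w \<notin> P \<Longrightarrow> G w < \<mu> - \<phi> - 2 * pi \<Longrightarrow> cmod w * sin (\<mu> - \<phi> - G w) \<le> s * sin (\<mu> - \<phi>)"
    unfolding P_def by blast
  define u where "u w = w * cis (- \<phi>)" for w
  have uw: "w = u w * cis \<phi>" for w by (simp add: u_def mult.assoc cis_mult)
  have u: "u w \<notin> P" if w: "w \<in> C" for w
  proof
    assume "u w \<in> P"
    then consider t where "0 \<le> t" "t \<le> s" "u w = of_real t"
      | t where "0 \<le> t" "u w = of_real s + of_real t * cis (\<mu> - \<phi>)"
      unfolding P_def by blast
    then show False
    proof cases
      case 1
      then show ?thesis using seg w uw[of w] by metis
    next
      case 2
      then have "w = of_real s * cis \<phi> + of_real t * cis \<mu>"
        using uw[of w] by (simp add: algebra_simps cis_mult)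
      then show ?thesis using ray 2 w by blast
    qed
  qed
  have cm: "cmod (u w) = cmod w" for w by (simp add: u_def norm_mult)
  have "\<exists>k::int. G (u w) + \<phi> - g w = 2 * pi * k" if w: "w \<in> C" for w
  proof -
    have "w \<noteq> 0" using seg[of 0] s w by auto
    have "of_real (cmod w) * cis (g w) = u w * cis \<phi>" using g(2)[OF w] uw by metis
    also have "\<dots> = of_real (cmod w) * cis (G (u w)) * cis \<phi>" using G(2)[OF u[OF w]] cm by metis
    finally have "cis (g w) = cis (G (u w) + \<phi>)" using \<open>w \<noteq> 0\<close> by (simp add: mult.assoc cis_mult)
    then have "cis (G (u w) + \<phi>) = cis (g w)" by simp
    then show ?thesis unfolding cis_eq_iff by auto
  qed
  then have "\<exists>N. \<forall>w\<in>C. G (u w) + \<phi> - g w = 2 * pi * of_int (N w)" by (intro bchoice) auto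
  then obtain N :: "complex \<Rightarrow> int" where N: "\<And>w. w \<in> C \<Longrightarrow> G (u w) + \<phi> - g w = 2 * pi * N w" by blast
  have "(\<lambda>w. (G (u w) + \<phi> - g w) / (2 * pi)) constant_on C"
  proof (rule continuous_discrete_range_constant[OF C])
    show "continuous_on C (\<lambda>w. (G (u w) + \<phi> - g w) / (2 * pi))"
      using u unfolding u_def
      by (intro continuous_intros g continuous_on_compose2[OF G(1)]) auto
    fix x assume x: "x \<in> C"
    show "\<exists>e>0. \<forall>y. y \<in> C \<and> (G (u y) + \<phi> - g y) / (2 * pi) \<noteq> (G (u x) + \<phi> - g x) / (2 * pi) \<longrightarrow>
        e \<le> norm ((G (u y) + \<phi> - g y) / (2 * pi) - (G (u x) + \<phi> - g x) / (2 * pi))"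
      using x by (intro exI[of _ 1]) (auto simp: N)
  qed
  then obtain c where c: "\<And>w. w \<in> C \<Longrightarrow> (G (u w) + \<phi> - g w) / (2 * pi) = c" unfolding constant_on_def by blast
  obtain M :: int where M: "\<And>w. w \<in> C \<Longrightarrow> G (u w) = g w + 2 * pi * M - \<phi>"
  proof (cases "C = {}")
    case False
    then obtain w0 where "w0 \<in> C" by blast
    then have "c = N w0" using c N by fastforce
    then have "G (u w) = g w + 2 * pi * N w0 - \<phi>" if "w \<in> C" for w
      using c[OF that] by (simp add: field_simps)
    then show ?thesis using that by blast
  qed (use that in blast)
  show ?thesis
  proof (rule that[of M])
    fix w assume w: "w \<in> C"
    show "\<phi> - 2 * pi < g w + 2 * pi * M \<and> g w + 2 * pi * M < \<mu>"
      using G(3)[OF u[OF w]] M[OF w] by auto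
    have e: "\<mu> - (g w + 2 * pi * M) = \<mu> - \<phi> - G (u w)" using M[OF w] by simp
    show "s * sin (\<mu> - \<phi>) \<le> cmod w * sin (\<mu> - (g w + 2 * pi * M))" if "\<phi> < g w + 2 * pi * M"
      unfolding e using G(4)[OF u[OF w]] M[OF w] that cm by auto
    show "cmod w * sin (\<mu> - (g w + 2 * pi * M)) \<le> s * sin (\<mu> - \<phi>)" if "g w + 2 * pi * M < \<mu> - 2 * pi"
      unfolding e using G(5)[OF u[OF w]] M[OF w] that cm by auto
  qed
qed

section \<open>Smooth tips\<close>

text \<open>Above the axis \<open>f\<close> has constant sign, say positive. Then \<open>f\<close> is positive along the ray, but negative
  in a flat cone below \<open>R\<close>; only rays almost opposite to the axis miss this cone.\<close>

lemma local_tip: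
  fixes f :: "complex \<Rightarrow> real" and R \<epsilon> r :: real
  assumes r: "r > 0" and cont: "continuous_on (ball (of_real R) r) f"
    and der: "(f has_derivative (\<lambda>v. c \<bullet> v)) (at (of_real R))" and c: "c \<noteq> 0"
    and f0: "f (of_real R) = 0"
    and zeros: "\<And>w. w \<in> ball (of_real R) r \<Longrightarrow> f w = 0 \<Longrightarrow> w \<in> K"
    and low: "\<And>w. w \<in> K \<Longrightarrow> w \<in> ball (of_real R) r \<Longrightarrow> Im w \<le> 0"
    and \<epsilon>: "\<epsilon> > 0"
  shows "\<exists>\<delta>>0. \<forall>s m. R - \<delta> < s \<longrightarrow> s < R \<longrightarrow> cmod m = 1 \<longrightarrow> Im m < 0 \<longrightarrow>
           (\<forall>t\<ge>0. of_real s + of_real t * m \<notin> K) \<longrightarrow> Re m < 0 \<and> - Im m < \<epsilon>"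
proof -
  let ?B = "ball (complex_of_real R) r"
  \<comment> \<open>The function and its gradient are quantified anew, so that the argument applies
    to \<open>- f\<close> as well.\<close>
  have main: ?thesis
    if up: "\<And>w. w \<in> ?B \<Longrightarrow> Im w > 0 \<Longrightarrow> f w > 0"
      and cont: "continuous_on ?B f" and der: "(f has_derivative (\<lambda>v. c \<bullet> v)) (at (of_real R))"
      and c: "c \<noteq> 0" and f0: "f (of_real R) = 0"
      and zeros: "\<And>w. w \<in> ?B \<Longrightarrow> f w = 0 \<Longrightarrow> w \<in> K" for f c
  proof -
    have small: "\<exists>d>0. \<forall>v. cmod v < d \<longrightarrow> \<bar>f (of_real R + v) - c \<bullet> v\<bar> \<le> e * cmod v" if e: "e > 0" for e
    proof -
      obtain d where d: "d > 0" "\<And>y. norm (y - of_real R) < d \<Longrightarrow>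
          norm (f y - f (of_real R) - c \<bullet> (y - of_real R)) \<le> e * norm (y - of_real R)"
        using der e unfolding has_derivative_at_alt by blast
      show ?thesis
        using d(1) d(2)[of "of_real R + v" for v] f0 by (intro exI[of _ d]) auto
    qed
    have nonneg: "c \<bullet> v \<ge> 0" if v: "Im v > 0" for v
    proof (rule ccontr)
      assume "\<not> c \<bullet> v \<ge> 0"
      then have neg: "c \<bullet> v < 0" by simp
      have "v \<noteq> 0" using v by auto
      define e where "e = - (c \<bullet> v) / (2 * cmod v)"
      have "e > 0" using neg \<open>v \<noteq> 0\<close> by (simp add: e_def divide_neg_pos)
      from small[OF this] obtain d where d: "d > 0" "\<And>v. cmod v < d \<Longrightarrow> \<bar>f (of_real R + v) - c \<bullet> v\<bar> \<le> e * cmod v" by blast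
      define t where "t = min d r / (2 * cmod v)"
      have t: "t > 0" "t * cmod v < d" "t * cmod v < r"
        using d r \<open>v \<noteq> 0\<close> by (auto simp: t_def min_def)
      have "f (of_real R + of_real t * v) > 0"
        using t v by (intro up) (auto simp: dist_norm norm_mult)
      moreover have "\<bar>f (of_real R + of_real t * v) - c \<bullet> (of_real t * v)\<bar> \<le> e * cmod (of_real t * v)"
        using t by (intro d) (auto simp: norm_mult)
      moreover have "c \<bullet> (of_real t * v) = t * (c \<bullet> v)" by (simp add: inner_complex_def algebra_simps)
      moreover have "e * cmod (of_real t * v) = - (t * (c \<bullet> v)) / 2"
        using t \<open>v \<noteq> 0\<close> by (simp add: e_def norm_mult)
      ultimately have "t * (c \<bullet> v) > 0" by linarith
      then show False using neg t by (simp add: zero_less_mult_iff)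
    qed
    have Rec: "Re c = 0"
    proof (rule ccontr)
      assume "Re c \<noteq> 0"
      \<comment> \<open>Were the gradient not vertical, some vector pointing above the axis would
        have inner product \<open>- 1\<close> with it.\<close>
      define n where "n = (- Im c - 1) / Re c"
      have "c \<bullet> Complex n 1 = - 1" using \<open>Re c \<noteq> 0\<close> by (simp add: inner_complex_def n_def)
      then show False using nonneg[of "Complex n 1"] by simp
    qed
    define \<kappa> where "\<kappa> = Im c"
    have "\<kappa> \<ge> 0" using nonneg[of \<i>] by (simp add: inner_complex_def \<kappa>_def)
    then have \<kappa>: "\<kappa> > 0" using c Rec by (auto simp: \<kappa>_def complex_eq_iff)
    have cv: "c \<bullet> v = \<kappa> * Im v" for v using Rec by (simp add: inner_complex_def \<kappa>_def)
    \<comment> \<open>Testing the ray at time \<open>d / 2\<close> costs a factor 2 and yields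
      \<open>- Im m \<le> 2 * \<eta> < \<epsilon>\<close>; moreover
      \<open>2 * \<eta> \<le> 1 / 2\<close> keeps \<open>Re m\<close> away from 0.\<close>
    define \<eta> where "\<eta> = min (\<epsilon> / 4) (1 / 4)"
    have \<eta>: "\<eta> > 0" "2 * \<eta> < \<epsilon>" "\<eta> \<le> 1 / 4" using \<epsilon> by (auto simp: \<eta>_def)
    from small[of "\<eta> * \<kappa>"] \<eta> \<kappa> obtain d0 where d0: "d0 > 0"
      "\<And>v. cmod v < d0 \<Longrightarrow> \<bar>f (of_real R + v) - \<kappa> * Im v\<bar> \<le> \<eta> * \<kappa> * cmod v" unfolding cv by auto
    define d where "d = min d0 r"
    have d: "d > 0" "d \<le> r" using d0 r by (auto simp: d_def)
    have flat: "- Im v \<le> \<eta> * cmod v" if "cmod v < d" "f (of_real R + v) > 0" for v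
    proof -
      have "\<kappa> * (- Im v) \<le> \<kappa> * (\<eta> * cmod v)" using d0(2)[of v] that by (auto simp: d_def ac_simps)
      then show ?thesis using \<kappa> by (simp only: mult_le_cancel_left_pos)
    qed
    show ?thesis
    proof (intro exI[of _ "d / 2"] conjI allI impI)
      show "d / 2 > 0" using d by simp
      fix s m
      assume s: "R - d / 2 < s" "s < R" and m: "cmod m = 1" "Im m < 0"
        and ray: "\<forall>t\<ge>0. of_real s + of_real t * m \<notin> K"
      have sB: "of_real s \<in> ?B" using s d by (simp add: dist_norm flip: of_real_diff)
      \<comment> \<open>On the axis the sign is known only as a limit from above. The start of a
        free ray is not a zero of \<open>f\<close>, which makes it strict.\<close>
      have "f (of_real s) \<ge> 0"
      proof (rule tendsto_lowerbound)
        show "((\<lambda>h. f (of_real s + of_real h * \<i>)) \<longlongrightarrow> f (of_real s)) (at_right 0)"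
        proof -
          have "isCont f (of_real s)" using cont sB by (simp add: continuous_on_eq_continuous_at)
          moreover have "((\<lambda>h. of_real s + of_real h * \<i>) \<longlongrightarrow> of_real s + of_real 0 * \<i>) (at_right 0)"
            by (intro tendsto_intros)
          ultimately show ?thesis by (intro isCont_tendsto_compose[of "of_real s" f]) auto
        qed
        have "\<forall>\<^sub>F h in at_right 0. h < r - (R - s)"
          using s d by (intro eventually_at_right_less[THEN eventually_mono] eventually_at_rightI[of 0 "r - (R - s)"]) auto
        then show "\<forall>\<^sub>F h in at_right 0. 0 \<le> f (of_real s + of_real h * \<i>)"
          using eventually_at_right_less[of 0]
        proof eventually_elim
          case (elim h)
          have "cmod (of_real R - (of_real s + of_real h * \<i>)) \<le> cmod (of_real (R - s)) + cmod (of_real h * \<i>)"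
            using norm_triangle_ineq4[of "of_real (R - s)" "of_real h * \<i>"] by (simp add: algebra_simps)
          also have "\<dots> < r" using elim s by (simp add: norm_mult del: of_real_diff)
          finally show ?case using elim by (intro less_imp_le up) (auto simp: dist_norm)
        qed
      qed simp
      moreover have "f (of_real s) \<noteq> 0" using zeros[OF sB] ray[rule_format, of 0] by auto
      ultimately have fs: "f (of_real s) > 0" by simp
      define v where "v t = complex_of_real (s - R) + of_real t * m" for t :: real
      have fv: "f (of_real R + v t) > 0" if t: "t \<ge> 0" "cmod (v t) < r" for t
      proof (rule ccontr)
        assume neg: "\<not> f (of_real R + v t) > 0"
        have seg: "of_real R + v t' \<in> ?B" if "0 \<le> t'" "t' \<le> t" for t'
        proof -
          have "of_real R + v t \<in> ?B" using t by (simp add: dist_norm)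
          then have "closed_segment (of_real s) (of_real R + v t) \<subseteq> ?B"
            using sB by (intro closed_segment_subset convex_ball) auto
          moreover have "of_real R + v t' = (1 - (if t = 0 then 0 else t' / t)) *\<^sub>R of_real s + (if t = 0 then 0 else t' / t) *\<^sub>R (of_real R + v t)"
            using that by (auto simp: v_def scaleR_conv_of_real field_simps)
          then have "of_real R + v t' \<in> closed_segment (of_real s) (of_real R + v t)"
            using that unfolding closed_segment_def
            by (intro CollectI exI[of _ "if t = 0 then 0 else t' / t"]) auto
          ultimately show ?thesis by blast
        qed
        have "continuous_on {0..t} (\<lambda>t'. f (of_real R + v t'))"
          using seg unfolding v_def
          by (intro continuous_on_compose2[OF cont] continuous_intros) auto
        moreover have "f (of_real R + v 0) > 0" using fs by (simp add: v_def)
        ultimately obtain t' where t': "0 \<le> t'" "t' \<le> t" "f (of_real R + v t') = 0"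
          using IVT2'[of "\<lambda>t'. f (of_real R + v t')" t 0 0] neg t by fastforce
        then have "of_real R + v t' \<in> K" using zeros seg by blast
        then show False using ray t' by (auto simp: v_def)
      qed
      define A where "A = Re m"
      define B where "B = - Im m"
      have AB: "A\<^sup>2 + B\<^sup>2 = 1" "B > 0"
        using m cmod_power2[of m] by (auto simp: A_def B_def)
      have Imv: "Im (v t) = - (t * B)" and Rev: "Re (v t) = (s - R) + t * A" for t
        by (simp_all add: v_def A_def B_def)
      have vn: "cmod (v t) \<le> (R - s) + t" if "t \<ge> 0" for t
        using norm_triangle_ineq[of "of_real (s - R)" "of_real t * m"] that s m
        by (simp add: v_def norm_mult del: of_real_diff)
      have "B \<le> 2 * \<eta>"
      proof -
        have lt: "cmod (v (d / 2)) < d" using vn[of "d / 2"] s d by simp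
        then have "- Im (v (d / 2)) \<le> \<eta> * cmod (v (d / 2))"
          using d by (intro flat fv) auto
        also have "\<dots> \<le> \<eta> * d" using \<eta> lt by (intro mult_left_mono) auto
        finally show ?thesis using d Imv by (simp add: field_simps)
      qed
      then show "- Im m < \<epsilon>" using \<eta> by (simp add: B_def)
      show "Re m < 0"
      proof (rule ccontr)
        assume "\<not> Re m < 0"
        then have "A \<ge> 0" by (simp add: A_def)
        have "B\<^sup>2 \<le> (1 / 2)\<^sup>2" using \<open>B \<le> 2 * \<eta>\<close> \<eta> AB by (intro power_mono) auto
        then have "(1 / 2)\<^sup>2 \<le> A\<^sup>2" using AB by (simp add: power2_eq_square)
        then have "1 / 2 \<le> A" using \<open>A \<ge> 0\<close> by (rule power2_le_imp_le)
        \<comment> \<open>A ray with \<open>Re m \<ge> 0\<close> would at this time be vertically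
          below the tip, well inside the cone where \<open>f\<close> is not positive.\<close>
        define t where "t = (R - s) / A"
        have "(R - s) * 1 \<le> (R - s) * (2 * A)" using s \<open>1 / 2 \<le> A\<close> by (intro mult_left_mono) auto
        then have t: "t > 0" "t \<le> 2 * (R - s)" using s \<open>1 / 2 \<le> A\<close> by (auto simp: t_def field_simps)
        have "Re (v t) = 0" using \<open>1 / 2 \<le> A\<close> by (simp add: Rev t_def)
        then have cv: "cmod (v t) = t * B" using Imv[of t] t AB by (simp add: cmod_def)
        have "t * B \<le> t * (1 / 2)" using \<open>B \<le> 2 * \<eta>\<close> \<eta> t by (intro mult_left_mono) auto
        then have "t * B \<le> t / 2" by simp
        also have "\<dots> \<le> R - s" using t by simp
        also have "\<dots> < d" using s d by simp
        finally have "t * B < d" .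
        then have lt: "cmod (v t) < d" using cv by simp
        then have "- Im (v t) \<le> \<eta> * cmod (v t)" using d t by (intro flat fv) auto
        then have "(1 - \<eta>) * (t * B) \<le> 0" using Imv[of t] cv by (simp add: algebra_simps)
        then show False using \<eta> t AB by (auto simp: mult_le_0_iff)
      qed
    qed
  qed
  have conn: "connected (?B \<inter> {w. Im w > 0})"
    by (intro convex_connected convex_Int convex_ball convex_halfspace_Im_gt)
  have "f w \<noteq> 0" if "w \<in> ?B \<inter> {w. Im w > 0}" for w
    using zeros[of w] low[of w] that by auto
  have img: "connected (f ` (?B \<inter> {w. Im w > 0}))"
    using conn cont by (intro connected_continuous_image) (auto intro: continuous_on_subset)
  have "(\<forall>w\<in>?B. Im w > 0 \<longrightarrow> f w > 0) \<or> (\<forall>w\<in>?B. Im w > 0 \<longrightarrow> f w < 0)"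
  proof (rule ccontr)
    assume "\<not> ?thesis"
    then obtain w1 w2 where w: "w1 \<in> ?B" "Im w1 > 0" "f w1 \<le> 0" "w2 \<in> ?B" "Im w2 > 0" "f w2 \<ge> 0"
      by (auto simp: not_less)
    then have "0 \<in> f ` (?B \<inter> {w. Im w > 0})"
      using connectedD_interval[OF img, of "f w1" "f w2" 0] by auto
    then show False using \<open>\<And>w. w \<in> ?B \<inter> {w. Im w > 0} \<Longrightarrow> f w \<noteq> 0\<close> by auto
  qed
  then show ?thesis
  proof
    assume "\<forall>w\<in>?B. Im w > 0 \<longrightarrow> f w > 0"
    then show ?thesis using main[of f c] cont der c f0 zeros by blast
  next
    assume "\<forall>w\<in>?B. Im w > 0 \<longrightarrow> f w < 0"
    moreover have "((\<lambda>w. - f w) has_derivative (\<lambda>v. (- c) \<bullet> v)) (at (of_real R))"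
      using has_derivative_minus[OF der] by simp
    ultimately show ?thesis
      using main[of "\<lambda>w. - f w" "- c"] cont c f0 zeros by (auto intro: continuous_on_minus)
  qed
qed

section \<open>Configurations of components around the origin\<close>

definition visible :: "complex set \<Rightarrow> complex \<Rightarrow> bool" where
  "visible K p \<longleftrightarrow> p \<in> K \<and> (\<forall>s\<in>{0..<1}. of_real s * p \<notin> K)"

definition blocked :: "complex set \<Rightarrow> bool" where
  "blocked K \<longleftrightarrow> (\<forall>\<theta>. \<exists>t>0. of_real t * cis \<theta> \<in> K)"

text \<open>This is the trace left by the approximating open sets: on the radial segment,
  arbitrarily close to each visible point, some point owns a ray that avoids
  \<open>K\<close>.\<close>

definition escapes :: "complex set \<Rightarrow> bool" where
  "escapes K \<longleftrightarrow> (\<forall>p. visible K p \<longrightarrow> (\<forall>\<epsilon>>0. \<exists>s m. 0 < s \<and> 1 - \<epsilon> < s \<and> s < 1 \<and> cmod m = 1 \<and>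
     (\<forall>t\<ge>0. of_real s * p + of_real t * m \<notin> K)))"

text \<open>Zeros of \<open>f\<close> are required to lie in \<open>K\<close>, so that
  \<open>f\<close> keeps its sign along a ray avoiding \<open>K\<close> as long as the ray stays in
  the ball.\<close>

definition smooth_at :: "complex set \<Rightarrow> complex \<Rightarrow> bool" where
  "smooth_at K p \<longleftrightarrow> (\<exists>r f c. r > 0 \<and> continuous_on (ball p r) f \<and> (f has_derivative (\<lambda>v. c \<bullet> v)) (at p) \<and>
     c \<noteq> 0 \<and> f p = (0::real) \<and> (\<forall>w\<in>ball p r. f w = 0 \<longrightarrow> w \<in> K))"

definition arc_config :: "complex set set \<Rightarrow> (complex \<Rightarrow> real) \<Rightarrow> bool" where
  "arc_config \<C> g \<longleftrightarrow> finite \<C> \<and> (\<forall>C\<in>\<C>. compact C \<and> connected C \<and> C \<noteq> {}) \<and> disjoint \<C> \<and>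
     continuous_on (\<Union>\<C>) g \<and> (\<forall>w\<in>\<Union>\<C>. w \<noteq> 0 \<and> w = of_real (cmod w) * cis (g w)) \<and>
     blocked (\<Union>\<C>) \<and> escapes (\<Union>\<C>) \<and> (\<forall>p. visible (\<Union>\<C>) p \<longrightarrow> smooth_at (\<Union>\<C>) p)"

text \<open>\<open>g\<close> is a branch of the argument on the union of the sets. The lift \<open>C, q\<close> (angles \<open>g w + 2 * pi * q\<close>)
  lies beyond the path iff \<open>q \<le> N C\<close>.\<close>

definition ccw_split_at :: "complex set set \<Rightarrow> (complex \<Rightarrow> real) \<Rightarrow> real \<Rightarrow> real \<Rightarrow> (complex set \<Rightarrow> int) \<Rightarrow> bool" where
  "ccw_split_at \<C> g \<phi> \<mu> N \<longleftrightarrow> \<phi> < \<mu> \<and> \<mu> < \<phi> + pi \<and>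
     (\<forall>C\<in>\<C>. \<forall>w\<in>C. \<phi> - 2 * pi < g w + 2 * pi * of_int (N C) \<and> g w + 2 * pi * of_int (N C) < \<mu>) \<and>
     (\<forall>C\<in>\<C>. \<forall>D\<in>\<C>. \<forall>w\<in>C. \<forall>v\<in>D. \<forall>q q'. q \<le> N C \<longrightarrow> N D < q' \<longrightarrow>
        g w + 2 * pi * of_int q = g v + 2 * pi * of_int q' \<longrightarrow> cmod v < cmod w)"

definition ccw_split :: "complex set set \<Rightarrow> (complex \<Rightarrow> real) \<Rightarrow> real \<Rightarrow> bool" where
  "ccw_split \<C> g \<phi> \<longleftrightarrow> (\<exists>\<mu> N. ccw_split_at \<C> g \<phi> \<mu> N)"

text \<open>Clockwise paths are counterclockwise paths of the reflected configuration, so the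
  geometry of rays is treated for one orientation.\<close>

definition cw_split :: "complex set set \<Rightarrow> (complex \<Rightarrow> real) \<Rightarrow> real \<Rightarrow> bool" where
  "cw_split \<C> g \<phi> \<longleftrightarrow> ccw_split ((`) cnj ` \<C>) (\<lambda>w. - g (cnj w)) (- \<phi>)"

section \<open>Invariance under reflection in the real axis\<close>

lemma cnj_image_iff: "w \<in> cnj ` K \<longleftrightarrow> cnj w \<in> K"
  by (metis complex_cnj_cnj image_iff)

lemma Union_cnj: "\<Union>((`) cnj ` \<C>) = cnj ` \<Union>\<C>"
  by auto

lemma visible_cnj: "visible (cnj ` K) p \<longleftrightarrow> visible K (cnj p)"
  by (auto simp: visible_def cnj_image_iff)

lemma blocked_cnj: assumes "blocked K" shows "blocked (cnj ` K)"
  unfolding blocked_def cnj_image_iff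
proof
  fix \<theta> show "\<exists>t>0. cnj (of_real t * cis \<theta>) \<in> K"
    using assms[unfolded blocked_def, rule_format, of "- \<theta>"] by (simp add: cis_cnj)
qed

lemma escapes_cnj: assumes "escapes K" shows "escapes (cnj ` K)"
  unfolding escapes_def visible_cnj cnj_image_iff
proof (intro allI impI)
  fix p and \<epsilon> :: real assume "visible K (cnj p)" "\<epsilon> > 0"
  then obtain s m where "0 < s" "1 - \<epsilon> < s" "s < 1" "cmod m = 1" "\<forall>t\<ge>0. of_real s * cnj p + of_real t * m \<notin> K"
    using assms unfolding escapes_def by blast
  then show "\<exists>s m. 0 < s \<and> 1 - \<epsilon> < s \<and> s < 1 \<and> cmod m = 1 \<and> (\<forall>t\<ge>0. cnj (of_real s * p + of_real t * m) \<notin> K)"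
    by (intro exI[of _ s] exI[of _ "cnj m"]) auto
qed

text \<open>Serves both the reflection and the rotation that brings a tip to the positive real axis;
  \<open>k\<close> is the adjoint of \<open>h\<close> and carries the gradient along.\<close>

lemma smooth_at_isometry:
  assumes sm: "smooth_at K (h p)" and h: "bounded_linear h" and iso: "\<And>v. cmod (h v) = cmod v"
    and adj: "\<And>c v. c \<bullet> h v = k c \<bullet> v" and k: "\<And>c. c \<noteq> 0 \<Longrightarrow> k c \<noteq> 0"
  shows "smooth_at (h -` K) p"
proof -
  obtain r f c where f: "r > 0" "continuous_on (ball (h p) r) f" "(f has_derivative (\<lambda>v. c \<bullet> v)) (at (h p))"
    "c \<noteq> 0" "f (h p) = (0::real)" "\<And>w. w \<in> ball (h p) r \<Longrightarrow> f w = 0 \<Longrightarrow> w \<in> K"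
    using sm unfolding smooth_at_def by blast
  interpret h: bounded_linear h by (rule h)
  have ball: "h w \<in> ball (h p) r" if "w \<in> ball p r" for w
    using that iso[of "p - w"] by (simp add: dist_norm h.diff)
  have "continuous_on (ball p r) (\<lambda>w. f (h w))"
    using ball by (intro continuous_on_compose2[OF f(2)] h.continuous_on continuous_on_id) auto
  moreover have "((\<lambda>w. f (h w)) has_derivative (\<lambda>v. k c \<bullet> v)) (at p)"
    using has_derivative_compose[OF h.has_derivative[OF has_derivative_ident] f(3)] by (simp add: adj)
  ultimately show ?thesis
    unfolding smooth_at_def using f k ball by (intro exI[of _ r] exI[of _ "\<lambda>w. f (h w)"] exI[of _ "k c"]) auto
qed

lemma smooth_at_cnj: assumes "smooth_at K (cnj p)" shows "smooth_at (cnj ` K) p"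
proof -
  have "cnj ` K = cnj -` K" by (auto simp: cnj_image_iff)
  then show ?thesis
    using smooth_at_isometry[OF assms bounded_linear_cnj, where k = cnj] by (simp add: inner_complex_def)
qed

lemma arc_config_cnj:
  assumes "arc_config \<C> g"
  shows "arc_config ((`) cnj ` \<C>) (\<lambda>w. - g (cnj w))"
  unfolding arc_config_def Union_cnj
proof (intro conjI ballI allI impI)
  note A = assms[unfolded arc_config_def]
  show "finite ((`) cnj ` \<C>)" using A by simp
  have cont: "continuous_on S cnj" for S by (intro continuous_intros)
  show "compact C" "connected C" "C \<noteq> {}" if "C \<in> (`) cnj ` \<C>" for C
    using that A by (auto intro!: compact_continuous_image connected_continuous_image cont)
  show "disjoint ((`) cnj ` \<C>)"
    unfolding disjoint_def
  proof (intro ballI impI)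
    fix X Y assume "X \<in> (`) cnj ` \<C>" "Y \<in> (`) cnj ` \<C>" "X \<noteq> Y"
    then obtain C D where CD: "C \<in> \<C>" "D \<in> \<C>" "C \<noteq> D" "X = cnj ` C" "Y = cnj ` D" by auto
    then have "C \<inter> D = {}" using A unfolding disjoint_def by blast
    then show "X \<inter> Y = {}" unfolding CD by (auto simp: cnj_image_iff)
  qed
  show "continuous_on (cnj ` \<Union>\<C>) (\<lambda>w. - g (cnj w))"
  proof (intro continuous_on_minus continuous_on_compose2[of "\<Union>\<C>" g _ cnj] cont)
    show "continuous_on (\<Union>\<C>) g" using A by blast
  qed auto
  show "w \<noteq> 0" if "w \<in> cnj ` \<Union>\<C>" for w using that A by auto
  show "w = of_real (cmod w) * cis (- g (cnj w))" if "w \<in> cnj ` \<Union>\<C>" for w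
  proof -
    have "cnj w = of_real (cmod (cnj w)) * cis (g (cnj w))" using that A by auto
    then have "cnj (cnj w) = cnj (of_real (cmod (cnj w)) * cis (g (cnj w)))" by (rule arg_cong)
    then show ?thesis by (simp add: cis_cnj)
  qed
  show "blocked (cnj ` \<Union>\<C>)" "escapes (cnj ` \<Union>\<C>)" using A blocked_cnj escapes_cnj by auto
  show "smooth_at (cnj ` \<Union>\<C>) p" if "visible (cnj ` \<Union>\<C>) p" for p
    using A that smooth_at_cnj unfolding visible_cnj by blast
qed

section \<open>Visible points and the paths towards them\<close>

lemma visible_exists:
  assumes K: "compact K" "0 \<notin> K" and t: "t > 0" "of_real t * cis \<theta> \<in> K"
  shows "\<exists>R>0. R \<le> t \<and> visible K (of_real R * cis \<theta>)"
proof -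
  define T where "T = {r. of_real r * cis \<theta> \<in> K} \<inter> {0..t}"
  have "closed {r. of_real r * cis \<theta> \<in> K}"
    using continuous_closed_vimage[OF compact_imp_closed[OF K(1)], of "\<lambda>r. of_real r * cis \<theta>"]
    by (simp add: vimage_def)
  then have T: "compact T" unfolding T_def by (intro closed_Int_compact) auto
  have "t \<in> T" using t by (simp add: T_def)
  then obtain R where R: "R \<in> T" "\<And>r. r \<in> T \<Longrightarrow> R \<le> r" using compact_attains_inf[OF T] by blast
  have "R \<noteq> 0" using R K by (auto simp: T_def)
  then have "R > 0" using R by (auto simp: T_def)
  have "visible K (of_real R * cis \<theta>)" unfolding visible_def
  proof (intro conjI ballI notI)
    show "of_real R * cis \<theta> \<in> K" using R by (simp add: T_def)
    fix s assume s: "s \<in> {0..<1}" "of_real s * (of_real R * cis \<theta>) \<in> K"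
    have "s * R \<le> R" using s \<open>R > 0\<close> by simp
    then have "s * R \<le> t" using R(1) unfolding T_def by (meson IntD2 atLeastAtMost_iff order_trans)
    then have "s * R \<in> T" using s \<open>R > 0\<close> by (simp add: T_def mult.assoc)
    then show False using R(2)[of "s * R"] s \<open>R > 0\<close> by simp
  qed
  then show ?thesis using \<open>R > 0\<close> R by (auto simp: T_def)
qed

lemma arc_config_Union:
  assumes "arc_config \<C> g"
  shows "compact (\<Union>\<C>)" "0 \<notin> \<Union>\<C>"
  using assms unfolding arc_config_def by auto

text \<open>If lifts from the two sides share an angle, the ranges force it between
  \<open>\<phi>\<close> and \<open>\<mu>\<close> and force \<open>q = N C\<close> and
  \<open>q' = N D + 1\<close>. On that radial line both distances are compared with that of the ray.
  Equal distances would mean a common point, hence by disjointness the same set and the same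
  lift.\<close>

lemma ccw_split_of_ray:
  assumes A: "arc_config \<C> g" and s: "0 < s" and \<mu>: "\<phi> < \<mu>" "\<mu> < \<phi> + pi"
    and seg: "\<And>t. 0 \<le> t \<Longrightarrow> t \<le> s \<Longrightarrow> of_real t * cis \<phi> \<notin> \<Union>\<C>"
    and ray: "\<And>t. 0 \<le> t \<Longrightarrow> of_real s * cis \<phi> + of_real t * cis \<mu> \<notin> \<Union>\<C>"
  shows "ccw_split \<C> g \<phi>"
proof -
  have "\<exists>N::int. \<forall>w\<in>C. (\<phi> - 2 * pi < g w + 2 * pi * N \<and> g w + 2 * pi * N < \<mu>) \<and>
     (\<phi> < g w + 2 * pi * N \<longrightarrow> s * sin (\<mu> - \<phi>) \<le> cmod w * sin (\<mu> - (g w + 2 * pi * N))) \<and>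
     (g w + 2 * pi * N < \<mu> - 2 * pi \<longrightarrow> cmod w * sin (\<mu> - (g w + 2 * pi * N)) \<le> s * sin (\<mu> - \<phi>))"
    if C: "C \<in> \<C>" for C
  proof -
    have 1: "connected C" "continuous_on C g" "\<And>w. w \<in> C \<Longrightarrow> w = of_real (cmod w) * cis (g w)"
      using A C unfolding arc_config_def by (auto intro: continuous_on_subset)
    have 2: "\<And>t. 0 \<le> t \<Longrightarrow> t \<le> s \<Longrightarrow> of_real t * cis \<phi> \<notin> C"
      "\<And>t. 0 \<le> t \<Longrightarrow> of_real s * cis \<phi> + of_real t * cis \<mu> \<notin> C"
      using seg ray C by blast+
    from ccw_slit_lift[OF 1 s \<mu> 2] show ?thesis by metis
  qed
  then obtain N :: "complex set \<Rightarrow> int" where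
    N: "\<And>C w. C \<in> \<C> \<Longrightarrow> w \<in> C \<Longrightarrow> \<phi> - 2 * pi < g w + 2 * pi * N C \<and> g w + 2 * pi * N C < \<mu>"
    "\<And>C w. C \<in> \<C> \<Longrightarrow> w \<in> C \<Longrightarrow> \<phi> < g w + 2 * pi * N C \<Longrightarrow>
        s * sin (\<mu> - \<phi>) \<le> cmod w * sin (\<mu> - (g w + 2 * pi * N C))"
    "\<And>C w. C \<in> \<C> \<Longrightarrow> w \<in> C \<Longrightarrow> g w + 2 * pi * N C < \<mu> - 2 * pi \<Longrightarrow>
        cmod w * sin (\<mu> - (g w + 2 * pi * N C)) \<le> s * sin (\<mu> - \<phi>)"
    by metis
  have front: "cmod v < cmod w"
    if CD: "C \<in> \<C>" "D \<in> \<C>" and w: "w \<in> C" and v: "v \<in> D" and q: "q \<le> N C" "N D < q'"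
      and eq: "g w + 2 * pi * q = g v + 2 * pi * q'" for C D w v and q q' :: int
  proof -
    define \<theta> where "\<theta> = g w + 2 * pi * q"
    have W: "g w + 2 * pi * N C = \<theta> + 2 * pi * of_int (N C - q)" by (simp add: \<theta>_def algebra_simps)
    have "\<theta> = g v + 2 * pi * q'" using eq by (simp add: \<theta>_def)
    then have V: "g v + 2 * pi * N D = \<theta> - 2 * pi * of_int (q' - N D)" by (simp add: algebra_simps)
    have "2 * pi * 1 \<le> 2 * pi * of_int (q' - N D)" using q by (intro mult_left_mono) auto
    then have \<theta>1: "\<phi> < \<theta>" using N(1)[OF CD(2) v] V by linarith
    have "N C = q"
    proof (rule ccontr)
      assume "N C \<noteq> q"
      then have "2 * pi * 1 \<le> 2 * pi * of_int (N C - q)" using q by (intro mult_left_mono) auto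
      then show False using N(1)[OF CD(1) w] W \<theta>1 \<mu> by linarith
    qed
    then have Wq: "g w + 2 * pi * N C = \<theta>" using W by simp
    then have \<theta>2: "\<theta> < \<mu>" using N(1)[OF CD(1) w] by simp
    have "q' - N D = 1"
    proof (rule ccontr)
      assume "q' - N D \<noteq> 1"
      then have "2 \<le> q' - N D" using q by simp
      then have "2 * pi * 2 \<le> 2 * pi * of_int (q' - N D)" by (intro mult_left_mono) (use pi_gt_zero in linarith)+
      then show False using N(1)[OF CD(2) v] V \<theta>2 \<mu> by linarith
    qed
    then have Vq: "g v + 2 * pi * N D = \<theta> - 2 * pi" using V by simp
    have "cmod v * sin (\<mu> - (\<theta> - 2 * pi)) \<le> s * sin (\<mu> - \<phi>)"
      using N(3)[OF CD(2) v] Vq \<theta>2 by simp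
    also have "\<dots> \<le> cmod w * sin (\<mu> - \<theta>)" using N(2)[OF CD(1) w] Wq \<theta>1 by simp
    also have "sin (\<mu> - (\<theta> - 2 * pi)) = sin (\<mu> - \<theta>)"
      using sin_periodic[of "\<mu> - \<theta>"] by (simp add: algebra_simps)
    finally have "cmod v * sin (\<mu> - \<theta>) \<le> cmod w * sin (\<mu> - \<theta>)" .
    moreover have "sin (\<mu> - \<theta>) > 0" using \<theta>1 \<theta>2 \<mu> by (intro sin_gt_zero) auto
    ultimately have "cmod v \<le> cmod w" by simp
    moreover have "cmod v \<noteq> cmod w"
    proof
      assume c: "cmod v = cmod w"
      have "cis (g w) = cis (g v)"
        unfolding cis_eq_iff using eq[symmetric] by (intro exI[of _ "q' - q"]) (simp add: algebra_simps)
      moreover have "w = of_real (cmod w) * cis (g w)" "v = of_real (cmod v) * cis (g v)"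
        using A CD w v unfolding arc_config_def by blast+
      ultimately have "v = w" using c by metis
      then have "C = D" using A CD w v unfolding arc_config_def disjoint_def by blast
      then show False using eq q \<open>v = w\<close> by simp
    qed
    ultimately show ?thesis by simp
  qed
  show ?thesis unfolding ccw_split_def ccw_split_at_def
  proof (intro exI[of _ \<mu>] exI[of _ N] conjI ballI allI impI)
    fix C D w v and q q' :: int
    assume "C \<in> \<C>" "D \<in> \<C>" "w \<in> C" "v \<in> D" "q \<le> N C" "N D < q'"
      "g w + 2 * pi * of_int q = g v + 2 * pi * of_int q'"
    then show "cmod v < cmod w" by (rule front)
  qed (use N(1) \<mu> in auto)
qed

lemma visible_segment:
  assumes "visible K (of_real R * cis \<phi>)" "0 \<le> t" "t < R"
  shows "of_real t * cis \<phi> \<notin> K"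
proof -
  have "t / R \<in> {0..<1}" using assms by auto
  then have "of_real (t / R) * (of_real R * cis \<phi>) \<notin> K" using assms(1) unfolding visible_def by blast
  then show ?thesis using assms by (simp add: mult.assoc[symmetric])
qed

lemma arc_config_sub:
  assumes "arc_config \<C> g" "C \<in> \<C>"
  shows "connected C" "compact C" "continuous_on C g" "\<And>w. w \<in> C \<Longrightarrow> w = of_real (cmod w) * cis (g w)"
    "\<And>w. w \<in> C \<Longrightarrow> w \<noteq> 0" "C \<noteq> {}"
  using assms unfolding arc_config_def by (auto intro: continuous_on_subset)

lemma unit_polar:
  assumes "cmod m = 1"
  obtains \<nu> where "m = cis (\<phi> + \<nu>)" "- pi < \<nu>" "\<nu> \<le> pi"
proof
  have "m * cis (- \<phi>) \<noteq> 0" using assms by auto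
  from cis_Arg[OF this] have "cis (Arg (m * cis (- \<phi>))) = m * cis (- \<phi>)"
    using assms by (simp add: sgn_div_norm norm_mult)
  then show "m = cis (\<phi> + Arg (m * cis (- \<phi>)))"
    unfolding cis_mult[symmetric] by (simp add: cis_mult mult.assoc mult.left_commute)
qed (use Arg_bounded in auto)

lemma arc_config_rays:
  assumes "arc_config \<C> g"
  shows "\<exists>t>0. of_real t * cis \<theta> \<in> \<Union>\<C>" "escapes (\<Union>\<C>)" "visible (\<Union>\<C>) p \<Longrightarrow> smooth_at (\<Union>\<C>) p"
proof -
  note A = assms[unfolded arc_config_def]
  have "blocked (\<Union>\<C>)" using A by (elim conjE)
  then show "\<exists>t>0. of_real t * cis \<theta> \<in> \<Union>\<C>" unfolding blocked_def by (rule spec)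
  show "escapes (\<Union>\<C>)" using A by (elim conjE)
  show "visible (\<Union>\<C>) p \<Longrightarrow> smooth_at (\<Union>\<C>) p" using A by simp
qed

text \<open>Radially outwards the ray would run into the visible point; radially inwards it would
  pass through the origin and meet \<open>K\<close> in the opposite direction, which is
  blocked.\<close>

lemma free_ray_oblique:
  assumes K: "blocked K" and vis: "visible K (of_real R * cis \<phi>)" and s: "0 < s" "s < R"
    and ray: "\<And>t. 0 \<le> t \<Longrightarrow> of_real s * cis \<phi> + of_real t * cis (\<phi> + \<nu>) \<notin> K"
  shows "\<nu> \<noteq> 0" "\<nu> \<noteq> pi"
proof -
  show "\<nu> \<noteq> 0"
  proof
    assume "\<nu> = 0"
    then have "of_real s * cis \<phi> + of_real (R - s) * cis \<phi> \<notin> K" using ray[of "R - s"] s by simp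
    moreover have "of_real s * cis \<phi> + of_real (R - s) * cis \<phi> = of_real R * cis \<phi>" by (simp add: algebra_simps)
    ultimately show False using vis unfolding visible_def by simp
  qed
  show "\<nu> \<noteq> pi"
  proof
    assume "\<nu> = pi"
    obtain t where t: "t > 0" "of_real t * cis (\<phi> + pi) \<in> K" using K unfolding blocked_def by blast
    have "of_real s * cis \<phi> + of_real (s + t) * cis (\<phi> + \<nu>) = of_real t * cis (\<phi> + pi)"
      unfolding \<open>\<nu> = pi\<close> cis_mult[symmetric] by (simp add: algebra_simps)
    then show False using ray[of "s + t"] t s by simp
  qed
qed

lemma split_of_free_ray:
  assumes A: "arc_config \<C> g" and vis: "visible (\<Union>\<C>) (of_real R * cis \<phi>)" and s: "0 < s" "s < R"
    and \<nu>: "- pi < \<nu>" "\<nu> \<le> pi"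
    and ray: "\<And>t. 0 \<le> t \<Longrightarrow> of_real s * cis \<phi> + of_real t * cis (\<phi> + \<nu>) \<notin> \<Union>\<C>"
  shows "0 < \<nu> \<and> \<nu> < pi \<and> ccw_split \<C> g \<phi> \<or> \<nu> < 0 \<and> cw_split \<C> g \<phi>"
proof -
  have seg: "of_real t * cis \<phi> \<notin> \<Union>\<C>" if "0 \<le> t" "t \<le> s" for t
    using visible_segment[OF vis] that s by simp
  have "blocked (\<Union>\<C>)" using A unfolding arc_config_def by (elim conjE)
  from free_ray_oblique[OF this vis s ray] have "\<nu> \<noteq> 0" "\<nu> \<noteq> pi" by auto
  moreover have "ccw_split \<C> g \<phi>" if "0 < \<nu>" "\<nu> < pi"
    by (rule ccw_split_of_ray[OF A s(1), of \<phi> "\<phi> + \<nu>"]) (use that seg ray in auto)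
  moreover have "cw_split \<C> g \<phi>" if "\<nu> < 0"
    unfolding cw_split_def
  proof (rule ccw_split_of_ray[OF arc_config_cnj[OF A] s(1), of "- \<phi>" "- (\<phi> + \<nu>)"])
    show "of_real t * cis (- \<phi>) \<notin> \<Union>((`) cnj ` \<C>)" if "0 \<le> t" "t \<le> s" for t
      using seg that unfolding Union_cnj cnj_image_iff by (simp add: cis_cnj)
    show "of_real s * cis (- \<phi>) + of_real t * cis (- (\<phi> + \<nu>)) \<notin> \<Union>((`) cnj ` \<C>)" if "0 \<le> t" for t
      using ray[OF that] unfolding Union_cnj cnj_image_iff by (simp add: cis_cnj add.commute)
  qed (use that \<nu> in auto)
  ultimately show ?thesis using \<nu> by linarith
qed

lemma ray_hit:
  assumes "arc_config \<C> g"
  shows "\<exists>R>0. visible (\<Union>\<C>) (of_real R * cis \<phi>)"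
  using arc_config_rays(1)[OF assms] visible_exists[OF arc_config_Union[OF assms]] by blast

lemma split_exists:
  assumes A: "arc_config \<C> g"
  shows "ccw_split \<C> g \<phi> \<or> cw_split \<C> g \<phi>"
proof -
  obtain R where R: "R > 0" "visible (\<Union>\<C>) (of_real R * cis \<phi>)" using ray_hit[OF A] by blast
  note esc = arc_config_rays(2)[OF A, unfolded escapes_def, rule_format]
  obtain s m where s: "0 < s" "s < 1" "cmod m = 1"
    and ray: "\<And>t. t\<ge>0 \<Longrightarrow> of_real s * (of_real R * cis \<phi>) + of_real t * m \<notin> \<Union>\<C>"
    using esc[OF R(2) zero_less_one] by auto
  obtain \<nu> where \<nu>: "m = cis (\<phi> + \<nu>)" "- pi < \<nu>" "\<nu> \<le> pi" using unit_polar[OF s(3)] by blast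
  have "0 < \<nu> \<and> \<nu> < pi \<and> ccw_split \<C> g \<phi> \<or> \<nu> < 0 \<and> cw_split \<C> g \<phi>"
    by (rule split_of_free_ray[OF A R(2), of "s * R"]) (use s R \<nu> ray in \<open>auto simp: mult.assoc\<close>)
  then show ?thesis by blast
qed

lemma direction_lift:
  assumes "arc_config \<C> g"
  obtains C w q where "C \<in> \<C>" "w \<in> C" "\<theta> = g w + 2 * pi * of_int q"
proof -
  obtain t where t: "t > 0" "of_real t * cis \<theta> \<in> \<Union>\<C>"
    using arc_config_rays(1)[OF assms] by blast
  then obtain C where C: "C \<in> \<C>" "of_real t * cis \<theta> \<in> C" by blast
  have "of_real t * cis \<theta> = of_real (cmod (of_real t * cis \<theta>)) * cis (g (of_real t * cis \<theta>))"
    using arc_config_sub(4)[OF assms C] .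
  then have "cis \<theta> = cis (g (of_real t * cis \<theta>))" using t by (simp add: norm_mult)
  then obtain q :: int where "\<theta> = g (of_real t * cis \<theta>) + 2 * pi * q" unfolding cis_eq_iff by blast
  then show ?thesis by (rule that[OF C])
qed

lemma lift_attains_min:
  assumes "arc_config \<C> g" "C \<in> \<C>"
  shows "\<exists>u\<in>C. \<forall>w\<in>C. g u \<le> g w"
  using continuous_attains_inf arc_config_sub[OF assms] by metis

text \<open>With finitely many sets, some interval after \<open>\<theta>\<close> contains no start
  of a lift. A lift covering a direction of this interval has therefore started at
  \<open>\<theta>\<close> or before.\<close>

lemma right_cover:
  assumes A: "arc_config \<C> g"
  obtains C u v q where "C \<in> \<C>" "u \<in> C" "v \<in> C" "g u + 2 * pi * of_int q \<le> \<theta>" "\<theta> < g v + 2 * pi * of_int q"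
proof -
  have "\<forall>C\<in>\<C>. \<exists>u. u \<in> C \<and> (\<forall>w\<in>C. g u \<le> g w)" using lift_attains_min[OF A] by blast
  then obtain u where u: "\<And>C. C \<in> \<C> \<Longrightarrow> u C \<in> C" "\<And>C w. C \<in> \<C> \<Longrightarrow> w \<in> C \<Longrightarrow> g (u C) \<le> g w" by metis
  define next_start where "next_start C = g (u C) + 2 * pi * of_int (\<lfloor>(\<theta> - g (u C)) / (2 * pi)\<rfloor> + 1)" for C
  have start: "\<theta> < next_start C" for C
  proof -
    have "(\<theta> - g (u C)) / (2 * pi) < of_int (\<lfloor>(\<theta> - g (u C)) / (2 * pi)\<rfloor> + 1)" by linarith
    then show ?thesis unfolding next_start_def by (simp add: field_simps)
  qed
  have least: "next_start C \<le> g (u C) + 2 * pi * of_int q" if "\<theta> < g (u C) + 2 * pi * of_int q" for C and q :: int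
  proof -
    have "(\<theta> - g (u C)) / (2 * pi) < of_int q" using that by (simp add: field_simps)
    then have "\<lfloor>(\<theta> - g (u C)) / (2 * pi)\<rfloor> + 1 \<le> q" by linarith
    then show ?thesis unfolding next_start_def by (intro add_left_mono mult_left_mono) auto
  qed
  have fin: "finite (next_start ` \<C>)" "next_start ` \<C> \<noteq> {}"
    using A direction_lift[OF A] unfolding arc_config_def by blast+
  define \<theta>' where "\<theta>' = (\<theta> + Min (next_start ` \<C>)) / 2"
  have "\<theta> < Min (next_start ` \<C>)" using start fin by simp
  then have \<theta>': "\<theta> < \<theta>'" "\<theta>' < Min (next_start ` \<C>)" by (auto simp: \<theta>'_def)
  obtain C v q where v: "C \<in> \<C>" "v \<in> C" "\<theta>' = g v + 2 * pi * of_int q" using direction_lift[OF A] by blast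
  have "g (u C) + 2 * pi * of_int q \<le> \<theta>'" using u(2)[OF v(1,2)] v(3) by simp
  also have "\<dots> < next_start C" using \<theta>'(2) fin v(1) by (meson Min_le image_eqI less_le_trans)
  finally have "g (u C) + 2 * pi * of_int q \<le> \<theta>" using least[of C q] by linarith
  then show ?thesis using that[OF v(1) u(1)[OF v(1)] v(2)] \<theta>' v(3) by auto
qed

text \<open>If all paths near the tip turned clockwise, they would tend to the line through the tip and the
  origin. But some component covers a right neighbourhood of the direction opposite to the tip, and the
  part of it on the near side of the path would be squeezed into the origin.\<close>

lemma tip_ccw:
  assumes A: "arc_config \<C> g" and C: "C \<in> \<C>" and p: "p \<in> C" "\<And>w. w \<in> C \<Longrightarrow> g w \<le> g p"
    and vis: "visible (\<Union>\<C>) p"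
  shows "ccw_split \<C> g (g p)"
proof (rule ccontr)
  assume neg: "\<not> ccw_split \<C> g (g p)"
  define R \<phi> where "R = cmod p" and "\<phi> = g p"
  have pR: "p = of_real R * cis \<phi>" using arc_config_sub(4)[OF A C p(1)] by (simp add: R_def \<phi>_def)
  have "R > 0" using arc_config_sub(5)[OF A C p(1)] by (simp add: R_def)
  define h where "h v = v * cis \<phi>" for v :: complex
  have hR: "h (of_real R) = p" by (simp add: h_def pR)
  have "smooth_at (\<Union>\<C>) (h (of_real R))" using arc_config_rays(3)[OF A vis] hR by simp
  moreover have "bounded_linear h" unfolding h_def by (rule bounded_linear_mult_left)
  ultimately have "smooth_at (h -` \<Union>\<C>) (of_real R)"
    by (rule smooth_at_isometry[where k = "\<lambda>c. c * cis (- \<phi>)"])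
       (auto simp: h_def norm_mult inner_complex_def algebra_simps)
  then obtain r0 f c where f: "r0 > 0" "continuous_on (ball (of_real R) r0) f"
    "(f has_derivative (\<lambda>v. c \<bullet> v)) (at (of_real R))" "c \<noteq> 0" "f (of_real R) = (0::real)"
    "\<And>w. w \<in> ball (of_real R) r0 \<Longrightarrow> f w = 0 \<Longrightarrow> w \<in> h -` \<Union>\<C>" unfolding smooth_at_def by blast
  have "\<exists>r>0. \<forall>w\<in>\<Union>\<C>. dist w p < r \<longrightarrow> w \<in> C \<and> \<bar>g w - g p\<bar> < pi"
  proof -
    have "closed (\<Union>(\<C> - {C}))" using A unfolding arc_config_def by (auto intro: compact_imp_closed)
    moreover have "p \<notin> \<Union>(\<C> - {C})" using A C p(1) unfolding arc_config_def disjoint_def by blast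
    ultimately obtain r1 where r1: "r1 > 0" "ball p r1 \<inter> \<Union>(\<C> - {C}) = {}"
      using open_contains_ball[of "- \<Union>(\<C> - {C})"] by (metis ComplI Compl_disjoint2 disjoint_eq_subset_Compl open_Compl)
    obtain r2 where r2: "r2 > 0" "\<And>w. w \<in> C \<Longrightarrow> dist w p < r2 \<Longrightarrow> dist (g w) (g p) < pi"
      using arc_config_sub(3)[OF A C] p(1) pi_gt_zero unfolding continuous_on_iff by metis
    show ?thesis
    proof (intro exI[of _ "min r1 r2"] conjI ballI impI)
      fix w assume w: "w \<in> \<Union>\<C>" "dist w p < min r1 r2"
      then have "w \<in> ball p r1" by (simp add: dist_commute)
      then show "w \<in> C" using r1(2) w(1) by blast
      then show "\<bar>g w - g p\<bar> < pi" using r2(2) w(2) by (simp add: dist_real_def)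
    qed (use r1 r2 in auto)
  qed
  then obtain r1 where r1: "r1 > 0" "\<And>w. w \<in> \<Union>\<C> \<Longrightarrow> dist w p < r1 \<Longrightarrow> w \<in> C \<and> \<bar>g w - g p\<bar> < pi" by blast
  define r where "r = min r0 r1"
  \<comment> \<open>In the rotated frame the tip lies on the positive real axis. Near it only
    \<open>C\<close> is present, with angles at most \<open>\<phi>\<close>, so nothing of it is
    above the axis.\<close>
  have low: "Im w \<le> 0" if w: "w \<in> h -` \<Union>\<C>" "w \<in> ball (of_real R) r" for w
  proof -
    have "dist (h w) p = dist w (of_real R)"
      unfolding hR[symmetric] h_def dist_norm by (simp add: norm_mult flip: left_diff_distrib)
    then have hw: "h w \<in> C" "\<bar>g (h w) - \<phi>\<bar> < pi" using r1(2)[of "h w"] w by (auto simp: r_def dist_commute \<phi>_def)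
    have "w = h w * cis (- \<phi>)" by (simp add: h_def mult.assoc cis_mult)
    also have "\<dots> = of_real (cmod (h w)) * cis (g (h w)) * cis (- \<phi>)" using arc_config_sub(4)[OF A C hw(1)] by metis
    also have "\<dots> = of_real (cmod (h w)) * cis (g (h w) - \<phi>)" by (simp add: mult.assoc cis_mult)
    finally have "Im w = cmod (h w) * sin (g (h w) - \<phi>)" by (metis Im_mult_cis)
    moreover have "sin (\<phi> - g (h w)) \<ge> 0" using hw p(2)[OF hw(1)] by (intro sin_ge_zero) (auto simp: \<phi>_def)
    ultimately show ?thesis using mult_nonneg_nonneg[OF norm_ge_zero, of "sin (\<phi> - g (h w))" "h w"]
      by (simp add: sin_diff algebra_simps)
  qed
  obtain D u v q where D: "D \<in> \<C>" "u \<in> D" "v \<in> D" "g u + 2 * pi * of_int q \<le> \<phi> - pi" "\<phi> - pi < g v + 2 * pi * of_int q"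
    using right_cover[OF A] by blast
  \<comment> \<open>A width to the right of \<open>\<phi> - pi\<close> that \<open>D\<close>
    certainly covers, capped so that the sine is monotone on the angles compared below.\<close>
  define \<omega> where "\<omega> = min (g v + 2 * pi * of_int q - \<phi> + pi) (pi / 2)"
  have \<omega>: "0 < \<omega>" using D(5) by (simp add: \<omega>_def)
  have \<omega>2: "\<omega> \<le> pi / 2" unfolding \<omega>_def by (rule min.cobounded2)
  have \<omega>v: "\<omega> \<le> g v + 2 * pi * of_int q - \<phi> + pi" unfolding \<omega>_def by (rule min.cobounded1)
  note \<omega> = \<omega> \<omega>2
  have gD: "connected (g ` D)" using arc_config_sub[OF A D(1)] by (intro connected_continuous_image)
  have "\<phi> - pi + \<omega> - 2 * pi * of_int q \<in> g ` D"
    by (rule connectedD_interval[OF gD imageI[OF D(2)] imageI[OF D(3)]]) (use D(4) \<omega>(1) \<omega>v in linarith)+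
  then obtain x where x: "x \<in> D" "g x = \<phi> - pi + \<omega> - 2 * pi * of_int q" by auto
  have "x \<noteq> 0" using arc_config_sub(5)[OF A D(1) x(1)] .
  have sin_half: "sin (\<omega> / 2) > 0" using \<omega> by (intro sin_gt_zero) auto
  \<comment> \<open>The first term forces the deviation \<open>\<psi>\<close> below
    \<open>\<omega> / 2\<close>; the second gives
    \<open>R * \<epsilon> \<le> cmod x * sin (\<omega> / 2)\<close>, which puts \<open>x\<close> too
    far out for the side of the origin.\<close>
  define \<epsilon> where "\<epsilon> = min (sin (\<omega> / 2)) (cmod x * sin (\<omega> / 2) / R)"
  have "\<epsilon> > 0" using sin_half \<open>x \<noteq> 0\<close> \<open>R > 0\<close> by (simp add: \<epsilon>_def)
  obtain \<delta> where \<delta>: "\<delta> > 0" "\<And>s m. R - \<delta> < s \<Longrightarrow> s < R \<Longrightarrow> cmod m = 1 \<Longrightarrow> Im m < 0 \<Longrightarrow>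
     (\<forall>t\<ge>0. of_real s + of_real t * m \<notin> h -` \<Union>\<C>) \<Longrightarrow> Re m < 0 \<and> - Im m < \<epsilon>"
  proof -
    have "continuous_on (ball (of_real R) r) f" using f(2) by (rule continuous_on_subset) (auto simp: r_def)
    moreover have "r > 0" using f r1 by (simp add: r_def)
    ultimately have "\<exists>\<delta>>0. \<forall>s m. R - \<delta> < s \<longrightarrow> s < R \<longrightarrow> cmod m = 1 \<longrightarrow> Im m < 0 \<longrightarrow>
           (\<forall>t\<ge>0. of_real s + of_real t * m \<notin> h -` \<Union>\<C>) \<longrightarrow> Re m < 0 \<and> - Im m < \<epsilon>"
      using f(6) low by (intro local_tip[of r R f c] f \<open>\<epsilon> > 0\<close>) (auto simp: r_def)
    then show ?thesis using that by blast
  qed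
  note esc = arc_config_rays(2)[OF A, unfolded escapes_def, rule_format]
  have "\<delta> / R > 0" using \<delta> \<open>R > 0\<close> by simp
  then obtain s m where s: "0 < s" "1 - \<delta> / R < s" "s < 1" "cmod m = 1"
    and ray: "\<And>t. t\<ge>0 \<Longrightarrow> of_real s * p + of_real t * m \<notin> \<Union>\<C>"
    using esc[OF vis] by blast
  obtain \<nu> where \<nu>: "m = cis (\<phi> + \<nu>)" "- pi < \<nu>" "\<nu> \<le> pi" using unit_polar[OF s(4)] by blast
  have sR: "0 < s * R" "s * R < R" "R - \<delta> < s * R" using s \<open>R > 0\<close> by (auto simp: field_simps)
  have ray': "of_real (s * R) * cis \<phi> + of_real t * cis (\<phi> + \<nu>) \<notin> \<Union>\<C>" if "t \<ge> 0" for t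
    using ray[OF that] by (simp add: pR \<nu>(1) mult.assoc)
  have "\<nu> < 0"
    using split_of_free_ray[OF A vis[unfolded pR] sR(1,2) \<nu>(2,3) ray'] neg by (auto simp: \<phi>_def)
  have "Im (cis \<nu>) < 0" using sin_gt_zero[of "- \<nu>"] \<nu> \<open>\<nu> < 0\<close> by simp
  moreover have "of_real (s * R) + of_real t * cis \<nu> \<notin> h -` \<Union>\<C>" if "t \<ge> 0" for t
    using ray'[OF that] by (simp add: h_def distrib_right mult.assoc cis_mult add.commute)
  ultimately have "Re (cis \<nu>) < 0" "- Im (cis \<nu>) < \<epsilon>"
    using \<delta>(2)[of "s * R" "cis \<nu>"] sR by auto
  then have cs: "cos \<nu> < 0" "- sin \<nu> < \<epsilon>" by simp_all
  define \<psi> where "\<psi> = \<nu> + pi"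
  have sin\<psi>: "sin \<psi> = - sin \<nu>" by (simp add: \<psi>_def)
  have "\<psi> < pi / 2"
    using cs(1) cos_ge_zero[of \<nu>] \<open>\<nu> < 0\<close> by (fastforce simp: \<psi>_def)
  have "0 < \<psi>" using \<nu> by (simp add: \<psi>_def)
  have "\<psi> < \<omega> / 2"
  proof (rule ccontr)
    assume "\<not> \<psi> < \<omega> / 2"
    then have "sin (\<omega> / 2) \<le> sin \<psi>" using \<open>\<psi> < pi / 2\<close> \<omega> by (intro sin_monotone_2pi_le) auto
    then show False using cs(2) sin\<psi> by (simp add: \<epsilon>_def)
  qed
  have cD: "connected (cnj ` D)" "continuous_on (cnj ` D) (\<lambda>w. - g (cnj w))"
    "\<And>w. w \<in> cnj ` D \<Longrightarrow> w = of_real (cmod w) * cis (- g (cnj w))"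
    using arc_config_sub[OF arc_config_cnj[OF A], of "cnj ` D"] D(1) by auto
  have seg: "of_real t * cis (- \<phi>) \<notin> cnj ` D" if "0 \<le> t" "t \<le> s * R" for t
    using visible_segment[OF vis[unfolded pR], of t] that sR D(1) unfolding cnj_image_iff by (auto simp: cis_cnj)
  have ray2: "of_real (s * R) * cis (- \<phi>) + of_real t * cis (- \<phi> - \<nu>) \<notin> cnj ` D" if "0 \<le> t" for t
    using ray'[OF that] D(1) unfolding cnj_image_iff by (auto simp: cis_cnj add.commute)
  obtain N :: int where N: "\<And>w. w \<in> cnj ` D \<Longrightarrow> - \<phi> - 2 * pi < - g (cnj w) + 2 * pi * N \<and> - g (cnj w) + 2 * pi * N < - \<phi> - \<nu>"
    "\<And>w. w \<in> cnj ` D \<Longrightarrow> - g (cnj w) + 2 * pi * N < - \<phi> - \<nu> - 2 * pi \<Longrightarrow>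
        cmod w * sin (- \<phi> - \<nu> - (- g (cnj w) + 2 * pi * N)) \<le> s * R * sin (- \<phi> - \<nu> - - \<phi>)"
    by (rule ccw_slit_lift[OF cD sR(1), of "- \<phi>" "- \<phi> - \<nu>"]) (use seg ray2 \<nu> \<open>\<nu> < 0\<close> in auto)
  have Nu: "- g u + 2 * pi * N < - \<phi> - \<nu>" using N(1)[of "cnj u"] D(2) by auto
  have Nx: "- \<phi> - 2 * pi < - g x + 2 * pi * N" using N(1)[of "cnj x"] x(1) by auto
  have two_pi: "0 < 2 * pi" by simp
  \<comment> \<open>The point \<open>u\<close>, at or before the direction opposite to the tip,
    bounds \<open>N\<close> from above, and \<open>x\<close> bounds it from below. The one remaining
    value places \<open>x\<close> on the side of the origin.\<close>
  have "2 * pi * (N + q) < 2 * pi * 0" using Nu D(4) \<open>0 < \<psi>\<close> by (simp add: \<psi>_def algebra_simps)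
  then have "of_int (N + q) < (0::real)" by (simp only: mult_less_cancel_left_pos[OF two_pi])
  moreover have "2 * pi * (- 2) < 2 * pi * (N + q)" using Nx x(2) \<omega> by (simp add: algebra_simps)
  then have "- 2 < real_of_int (N + q)" by (simp only: mult_less_cancel_left_pos[OF two_pi])
  ultimately have "N = - q - 1" by linarith
  then have N': "real_of_int N = - real_of_int q - 1" by simp
  have gx: "- g x + 2 * pi * N = - \<phi> - pi - \<omega>" unfolding N' x(2) by (simp add: algebra_simps)
  have "cmod (cnj x) * sin (- \<phi> - \<nu> - (- g (cnj (cnj x)) + 2 * pi * N)) \<le> s * R * sin (- \<phi> - \<nu> - - \<phi>)"
    using x(1) gx \<open>\<psi> < \<omega> / 2\<close> \<omega> by (intro N(2)) (auto simp: \<psi>_def)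
  moreover have "- \<phi> - \<nu> - (- g (cnj (cnj x)) + 2 * pi * N) = \<omega> - \<psi> + 2 * pi"
    unfolding complex_cnj_cnj gx by (simp add: \<psi>_def)
  ultimately have "cmod x * sin (\<omega> - \<psi>) \<le> s * R * sin \<psi>" by (simp only: sin_periodic complex_mod_cnj) (simp add: sin\<psi>)
  also have "\<dots> < R * \<epsilon>"
    using sR cs(2) sin\<psi> sin_gt_zero[of \<psi>] \<open>0 < \<psi>\<close> \<open>\<psi> < pi / 2\<close> \<open>\<epsilon> > 0\<close> by (intro mult_strict_mono) auto
  also have "\<dots> \<le> R * (cmod x * sin (\<omega> / 2) / R)" using \<open>R > 0\<close> by (intro mult_left_mono) (auto simp: \<epsilon>_def)
  also have "\<dots> = cmod x * sin (\<omega> / 2)" using \<open>R > 0\<close> by simp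
  also have "\<dots> \<le> cmod x * sin (\<omega> - \<psi>)"
    using \<open>0 < \<psi>\<close> \<open>\<psi> < \<omega> / 2\<close> \<omega> by (intro mult_left_mono sin_monotone_2pi_le) auto
  finally show False by simp
qed

section \<open>From configurations to chains\<close>

definition arc_start :: "(complex \<Rightarrow> real) \<Rightarrow> complex set \<Rightarrow> real" where
  "arc_start g C = Inf (g ` C)"

definition arc_end :: "(complex \<Rightarrow> real) \<Rightarrow> complex set \<Rightarrow> real" where
  "arc_end g C = Sup (g ` C)"

lemma arc_image:
  assumes "arc_config \<C> g" "C \<in> \<C>"
  shows "g ` C = {arc_start g C..arc_end g C}" "arc_start g C \<le> arc_end g C"
proof -
  have "compact (g ` C)" "connected (g ` C)"
    using arc_config_sub[OF assms] by (auto intro: compact_continuous_image connected_continuous_image)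
  then obtain x y where xy: "g ` C = {x..y}" using connected_compact_interval_1 by blast
  moreover have "x \<le> y" using xy arc_config_sub(6)[OF assms] by auto
  ultimately show "g ` C = {arc_start g C..arc_end g C}" "arc_start g C \<le> arc_end g C"
    by (simp_all add: arc_start_def arc_end_def)
qed

lemma arc_bounds:
  assumes "arc_config \<C> g" "C \<in> \<C>" "w \<in> C"
  shows "arc_start g C \<le> g w" "g w \<le> arc_end g C"
  using arc_image(1)[OF assms(1,2)] assms(3) by (metis atLeastAtMost_iff imageI)+

lemma arc_lift:
  assumes "arc_config \<C> g" "C \<in> \<C>" "\<theta> \<in> {arc_start g C + x..arc_end g C + x}"
  shows "\<exists>w\<in>C. g w + x = \<theta>"
proof -
  have "\<theta> - x \<in> g ` C" unfolding arc_image(1)[OF assms(1,2)] using assms(3) by auto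
  then obtain w where "w \<in> C" "g w = \<theta> - x" by (metis imageE)
  then show ?thesis by (intro bexI[of _ w]) auto
qed

lemma ccw_split_atD:
  assumes "ccw_split_at \<C> g \<phi> \<mu> N"
  shows "\<phi> < \<mu>" "\<mu> < \<phi> + pi"
    "\<And>C w. C \<in> \<C> \<Longrightarrow> w \<in> C \<Longrightarrow> \<phi> - 2 * pi < g w + 2 * pi * of_int (N C)"
    "\<And>C w. C \<in> \<C> \<Longrightarrow> w \<in> C \<Longrightarrow> g w + 2 * pi * of_int (N C) < \<mu>"
    "\<And>C D w v q q'. C \<in> \<C> \<Longrightarrow> D \<in> \<C> \<Longrightarrow> w \<in> C \<Longrightarrow> v \<in> D \<Longrightarrow> q \<le> N C \<Longrightarrow> N D < q' \<Longrightarrow>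
        g w + 2 * pi * of_int q = g v + 2 * pi * of_int q' \<Longrightarrow> cmod v < cmod w"
  using assms unfolding ccw_split_at_def by simp_all

lemma ccw_split_shift:
  assumes "ccw_split \<C> g \<phi>"
  shows "ccw_split \<C> g (\<phi> + 2 * pi * of_int m)"
proof -
  obtain \<mu> N where "ccw_split_at \<C> g \<phi> \<mu> N" using assms unfolding ccw_split_def by blast
  note N = ccw_split_atD[OF this]
  show ?thesis unfolding ccw_split_def ccw_split_at_def
  proof (intro exI[of _ "\<mu> + 2 * pi * of_int m"] exI[of _ "\<lambda>C. N C + m"] conjI ballI allI impI)
    fix C D w v q q'
    assume h: "C \<in> \<C>" "D \<in> \<C>" "w \<in> C" "v \<in> D" "q \<le> N C + m" "N D + m < q'"
      "g w + 2 * pi * of_int q = g v + 2 * pi * of_int q'"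
    show "cmod v < cmod w"
      by (rule N(5)[OF h(1-4), of "q - m" "q' - m"]) (use h in \<open>auto simp: algebra_simps\<close>)
  qed (use N(1,2) N(3,4) in \<open>auto simp: algebra_simps\<close>)
qed

text \<open>Here \<open>c\<close> runs cyclically through the components and \<open>q k\<close>
  counts the turns of lift \<open>k\<close>. By \<open>surj\<close> every lift occurs, so whatever
  hides a point from the origin is found at some index.\<close>

locale config_chain =
  fixes \<C> :: "complex set set" and g :: "complex \<Rightarrow> real" and n :: int
    and c :: "int \<Rightarrow> complex set" and q :: "int \<Rightarrow> int"
  assumes config: "arc_config \<C> g" and n23: "n = 2 \<or> n = 3"
    and c_in: "c k \<in> \<C>" and c_period: "c (k + n) = c k" and q_period: "q (k + n) = q k + 1"
    and surj: "C \<in> \<C> \<Longrightarrow> \<exists>k. c k = C \<and> q k = m"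
    and arc_overlap: "arc_start g (c (k + 1)) + 2 * pi * q (k + 1) \<le> arc_end g (c k) + 2 * pi * q k"
    and arc_gap: "arc_end g (c k) + 2 * pi * q k < arc_start g (c (k + 2)) + 2 * pi * q (k + 2)"
begin

definition a :: "int \<Rightarrow> real" where "a k = arc_start g (c k) + 2 * pi * q k"
definition b :: "int \<Rightarrow> real" where "b k = arc_end g (c k) + 2 * pi * q k"
definition \<rho> :: "int \<Rightarrow> real \<Rightarrow> real" where "\<rho> k \<theta> = Inf (cmod ` {w \<in> c k. g w + 2 * pi * q k = \<theta>})"

sublocale angular_chain n a b \<rho>
proof
  show "n = 2 \<or> n = 3" by (rule n23)
  show "a (k + n) = a k + 2 * pi" "b (k + n) = b k + 2 * pi" for k
    by (simp_all add: a_def b_def c_period q_period algebra_simps)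
  show "\<rho> (k + n) (\<theta> + 2 * pi) = \<rho> k \<theta>" for k \<theta>
    by (simp add: \<rho>_def c_period q_period algebra_simps)
  show "a (k + 1) \<le> b k" "b k < a (k + 2)" for k
    using arc_overlap[of k] arc_gap[of k] by (simp_all add: a_def b_def)
qed

lemma ab_bounds: "w \<in> c k \<Longrightarrow> g w + 2 * pi * q k \<in> {a k..b k}"
  using arc_bounds[OF config c_in] by (simp add: a_def b_def)

lemma lift_in: "\<theta> \<in> {a k..b k} \<Longrightarrow> \<exists>w\<in>c k. g w + 2 * pi * q k = \<theta>"
  unfolding a_def b_def by (rule arc_lift[OF config c_in])

lemma a_le_b: "a k \<le> b k"
  using arc_image(2)[OF config c_in] by (simp add: a_def b_def)

lemma \<rho>_attained:
  assumes "\<theta> \<in> {a k..b k}"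
  obtains w where "w \<in> c k" "g w + 2 * pi * q k = \<theta>" "cmod w = \<rho> k \<theta>"
proof -
  define T where "T = c k \<inter> g -` {\<theta> - 2 * pi * q k}"
  have "closed T" unfolding T_def
    using arc_config_sub[OF config c_in] by (intro continuous_closed_preimage compact_imp_closed) auto
  then have "compact (c k \<inter> T)" using arc_config_sub(2)[OF config c_in] by (intro compact_Int_closed)
  then have "compact T" by (simp add: T_def)
  moreover have T: "T = {w \<in> c k. g w + 2 * pi * q k = \<theta>}" by (auto simp: T_def)
  moreover have "T \<noteq> {}" using lift_in[OF assms] unfolding T by auto
  ultimately obtain w where w: "w \<in> T" "\<And>v. v \<in> T \<Longrightarrow> cmod w \<le> cmod v"
    using continuous_attains_inf[of T cmod] continuous_on_norm_id by blast
  then have "Inf (cmod ` T) = cmod w" by (intro cInf_eq_minimum) auto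
  then show ?thesis using that[of w] w(1) unfolding \<rho>_def T by auto
qed

lemma \<rho>_le: "w \<in> c k \<Longrightarrow> g w + 2 * pi * q k = \<theta> \<Longrightarrow> \<rho> k \<theta> \<le> cmod w"
  unfolding \<rho>_def by (intro cInf_lower bdd_belowI[of _ 0]) auto

lemma ccw_of_split:
  assumes "ccw_split \<C> g \<phi>"
  shows "ccw \<phi>"
proof -
  obtain \<mu> N where "ccw_split_at \<C> g \<phi> \<mu> N" using assms unfolding ccw_split_def by blast
  note N = ccw_split_atD[OF this]
  have "ccw_cut \<phi> \<mu> {k. q k \<le> N (c k)}"
    unfolding ccw_cut_def
  proof (intro conjI ballI allI impI)
    show "b k < \<mu>" if "k \<in> {k. q k \<le> N (c k)}" for k
    proof -
      obtain w where w: "w \<in> c k" "g w + 2 * pi * q k = b k" using lift_in[of "b k" k] a_le_b by auto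
      have "2 * pi * q k \<le> 2 * pi * N (c k)" using that by (intro mult_left_mono) auto
      then show ?thesis using N(4)[OF c_in w(1)] w(2) by linarith
    qed
    show "\<phi> < a k" if "k \<notin> {k. q k \<le> N (c k)}" for k
    proof -
      obtain w where w: "w \<in> c k" "g w + 2 * pi * q k = a k" using lift_in[of "a k" k] a_le_b by auto
      have "2 * pi * (N (c k) + 1) \<le> 2 * pi * q k" using that by (intro mult_left_mono) auto
      then show ?thesis using N(3)[OF c_in w(1)] w(2) by (simp add: algebra_simps)
    qed
    show "\<rho> j \<theta> < \<rho> k \<theta>" if k: "k \<in> {k. q k \<le> N (c k)}" and j: "j \<notin> {k. q k \<le> N (c k)}"
      and \<theta>: "\<theta> \<in> {a k..b k} \<inter> {a j..b j}" for k j \<theta>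
    proof -
      obtain w where w: "w \<in> c k" "g w + 2 * pi * q k = \<theta>" "cmod w = \<rho> k \<theta>" using \<rho>_attained \<theta> by blast
      obtain v where v: "v \<in> c j" "g v + 2 * pi * q j = \<theta>" "cmod v = \<rho> j \<theta>" using \<rho>_attained \<theta> by blast
      have "cmod v < cmod w" by (rule N(5)[OF c_in c_in w(1) v(1), of "q k" "q j"]) (use k j w v in auto)
      then show ?thesis using w v by simp
    qed
  qed (use N in auto)
  then show ?thesis unfolding ccw_def by blast
qed

lemma cw_of_split:
  assumes "cw_split \<C> g \<phi>"
  shows "cw \<phi>"
proof -
  obtain \<mu> N' where "ccw_split_at ((`) cnj ` \<C>) (\<lambda>w. - g (cnj w)) (- \<phi>) \<mu> N'"
    using assms unfolding cw_split_def ccw_split_def by blast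
  note N' = ccw_split_atD[OF this]
  define N where "N C = N' (cnj ` C)" for C
  have N: "- \<phi> - 2 * pi < - g w + 2 * pi * of_int (N C)" "- g w + 2 * pi * of_int (N C) < \<mu>"
    if "C \<in> \<C>" "w \<in> C" for C w
    using N'(3,4)[of "cnj ` C" "cnj w"] that by (auto simp: N_def)
  have "cw_cut \<phi> (- \<mu>) {k. - q k \<le> N (c k)}"
    unfolding cw_cut_def
  proof (intro conjI ballI allI impI)
    show "- \<mu> < a k" if "k \<in> {k. - q k \<le> N (c k)}" for k
    proof -
      obtain w where w: "w \<in> c k" "g w + 2 * pi * q k = a k" using lift_in[of "a k" k] a_le_b by auto
      have "2 * pi * - q k \<le> 2 * pi * N (c k)"
        by (intro mult_left_mono) (use that in \<open>auto simp flip: of_int_minus\<close>)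
      then show ?thesis using N(2)[OF c_in w(1)] w(2) by simp
    qed
    show "b k < \<phi>" if "k \<notin> {k. - q k \<le> N (c k)}" for k
    proof -
      obtain w where w: "w \<in> c k" "g w + 2 * pi * q k = b k" using lift_in[of "b k" k] a_le_b by auto
      have "N (c k) + 1 \<le> - q k" using that by simp
      then have "real_of_int (N (c k)) + 1 \<le> - q k" by linarith
      then have "2 * pi * (N (c k) + 1) \<le> 2 * pi * - q k" by (intro mult_left_mono) auto
      then show ?thesis using N(1)[OF c_in w(1)] w(2) by (simp add: algebra_simps)
    qed
    show "\<rho> j \<theta> < \<rho> k \<theta>" if k: "k \<in> {k. - q k \<le> N (c k)}" and j: "j \<notin> {k. - q k \<le> N (c k)}"
      and \<theta>: "\<theta> \<in> {a k..b k} \<inter> {a j..b j}" for k j \<theta>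
    proof -
      obtain w where w: "w \<in> c k" "g w + 2 * pi * q k = \<theta>" "cmod w = \<rho> k \<theta>" using \<rho>_attained \<theta> by blast
      obtain v where v: "v \<in> c j" "g v + 2 * pi * q j = \<theta>" "cmod v = \<rho> j \<theta>" using \<rho>_attained \<theta> by blast
      have "cmod (cnj v) < cmod (cnj w)"
      proof (rule N'(5)[of "cnj ` c k" "cnj ` c j" "cnj w" "cnj v" "- q k" "- q j"])
        show "- g (cnj (cnj w)) + 2 * pi * of_int (- q k) = - g (cnj (cnj v)) + 2 * pi * of_int (- q j)"
          using w(2) v(2) by simp
      qed (use k j w v c_in in \<open>auto simp: N_def\<close>)
      then show ?thesis using w v by simp
    qed
  qed (use N'(1,2) in auto)
  then show ?thesis unfolding cw_def by blast
qed

lemma visible_of_nearest: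
  assumes p: "p \<in> c k" "g p + 2 * pi * q k = \<theta>"
    and near: "\<And>j. \<theta> \<in> {a j..b j} \<Longrightarrow> cmod p \<le> \<rho> j \<theta>"
  shows "visible (\<Union>\<C>) p"
  unfolding visible_def
proof (intro conjI ballI notI)
  show "p \<in> \<Union>\<C>" using p c_in by blast
  fix s :: real assume s: "s \<in> {0..<1}" "of_real s * p \<in> \<Union>\<C>"
  then obtain C where C: "C \<in> \<C>" "of_real s * p \<in> C" by blast
  have p0: "p \<noteq> 0" "of_real s * p \<noteq> 0" using arc_config_sub(5)[OF config] p(1) c_in C by blast+
  then have "s > 0" using s by auto
  have "of_real s * p = of_real (cmod (of_real s * p)) * cis (g (of_real s * p))"
    using arc_config_sub(4)[OF config C] .
  also have "\<dots> = of_real s * (of_real (cmod p) * cis (g (of_real s * p)))" using \<open>s > 0\<close> by (simp add: norm_mult)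
  finally have "p = of_real (cmod p) * cis (g (of_real s * p))" using \<open>s > 0\<close> by simp
  then have "of_real (cmod p) * cis (g p) = of_real (cmod p) * cis (g (of_real s * p))"
    using arc_config_sub(4)[OF config c_in p(1)] by metis
  then have "cis (g p) = cis (g (of_real s * p))" using p0 by simp
  then obtain m :: int where m: "g p = g (of_real s * p) + 2 * pi * m" unfolding cis_eq_iff by blast
  obtain j where j: "c j = C" "q j = m + q k" using surj[OF C(1)] by blast
  have e: "g (of_real s * p) + 2 * pi * q j = \<theta>" using p(2) m j by (simp add: algebra_simps)
  have "\<theta> \<in> {a j..b j}" using ab_bounds[of "of_real s * p" j] C j e by metis
  then have "cmod p \<le> \<rho> j \<theta>" by (rule near)
  also have "\<dots> \<le> cmod (of_real s * p)" using \<rho>_le[OF _ e] C j by blast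
  also have "\<dots> < cmod p" using s p0 \<open>s > 0\<close> by (simp add: norm_mult)
  finally show False by simp
qed

text \<open>At the angle \<open>b k\<close> only the lifts \<open>k\<close> and \<open>k + 1\<close>
  can be present: earlier arcs have ended, and by \<open>gap\<close> later ones have not begun. As
  \<open>k\<close> is in front, its nearest point there is visible, so the smoothness argument for
  tips applies.\<close>

lemma FR_imp_ccw:
  assumes "FR k"
  shows "ccw (b k)"
proof -
  obtain p where p: "p \<in> c k" "g p + 2 * pi * q k = b k" "cmod p = \<rho> k (b k)"
    using \<rho>_attained[of "b k" k] a_le_b by auto
  have "visible (\<Union>\<C>) p"
  proof (rule visible_of_nearest[OF p(1,2)])
    fix j assume j: "b k \<in> {a j..b j}"
    then have "a j < a (k + 2)" "b k \<le> b j" using gap[of k] by auto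
    then have "k \<le> j" "j < k + 2" using strict_mono_a strict_mono_b by (simp_all add: strict_mono_less strict_mono_less_eq)
    then consider "j = k" | "j = k + 1" by linarith
    then show "cmod p \<le> \<rho> j (b k)"
      using assms j p(3) unfolding FR_def by cases force+
  qed
  moreover have "g w \<le> g p" if "w \<in> c k" for w using ab_bounds[OF that] p(2) by simp
  ultimately have "ccw_split \<C> g (g p)" using tip_ccw[OF config c_in p(1)] by blast
  then show ?thesis using ccw_of_split ccw_split_shift p(2) by metis
qed

text \<open>The tip now belongs to lift \<open>k + 1\<close> and is the start of its arc; reflection
  turns it into an end.\<close>

lemma BR_imp_cw:
  assumes "BR k"
  shows "cw (a (k + 1))"
proof -
  obtain p where p: "p \<in> c (k + 1)" "g p + 2 * pi * q (k + 1) = a (k + 1)" "cmod p = \<rho> (k + 1) (a (k + 1))"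
    using \<rho>_attained[of "a (k + 1)" "k + 1"] a_le_b by auto
  have "visible (\<Union>\<C>) p"
  proof (rule visible_of_nearest[OF p(1,2)])
    fix j assume j: "a (k + 1) \<in> {a j..b j}"
    have "b (k - 1) < a (k + 1)" using gap[of "k - 1"] by (simp add: algebra_simps)
    then have "b (k - 1) < b j" using j by simp
    moreover have "a j \<le> a (k + 1)" using j by simp
    ultimately have "k - 1 < j" "j \<le> k + 1"
      using strict_mono_a strict_mono_b by (simp_all add: strict_mono_less strict_mono_less_eq)
    then consider "j = k" | "j = k + 1" by linarith
    then show "cmod p \<le> \<rho> j (a (k + 1))"
      using assms j p(3) unfolding BR_def by cases force+
  qed
  then have vis: "visible (\<Union>((`) cnj ` \<C>)) (cnj p)" unfolding Union_cnj visible_cnj by simp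
  have "- g (cnj w) \<le> - g (cnj (cnj p))" if "w \<in> cnj ` c (k + 1)" for w
    using ab_bounds[of "cnj w" "k + 1"] that p(2) by (auto simp: cnj_image_iff)
  then have "ccw_split ((`) cnj ` \<C>) (\<lambda>w. - g (cnj w)) (- g (cnj (cnj p)))"
    using tip_ccw[OF arc_config_cnj[OF config], of "cnj ` c (k + 1)" "cnj p"] vis p(1) c_in by blast
  then have "ccw_split ((`) cnj ` \<C>) (\<lambda>w. - g (cnj w)) (- g (cnj (cnj p)) + 2 * pi * of_int (- q (k + 1)))"
    by (rule ccw_split_shift)
  moreover have "- g (cnj (cnj p)) + 2 * pi * of_int (- q (k + 1)) = - a (k + 1)" using p(2) by simp
  ultimately have "cw_split \<C> g (a (k + 1))" unfolding cw_split_def by metis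
  then show ?thesis by (rule cw_of_split)
qed

lemma chain_False: False
  using no_cut_system split_exists[OF config] ccw_of_split cw_of_split FR_imp_ccw BR_imp_cw by blast

end

section \<open>Cyclic arrangement of the arcs of a minimal blocking family\<close>

lemma arc_short:
  assumes A: "arc_config \<C> g" and C: "C \<in> \<C>"
  shows "arc_end g C < arc_start g C + 2 * pi"
proof (rule ccontr)
  assume "\<not> ?thesis"
  then obtain w v where w: "w \<in> C" "g w = arc_start g C" and v: "v \<in> C" "g v = arc_start g C + 2 * pi"
    using arc_lift[OF A C, of _ 0] arc_image(2)[OF A C] by (metis add.right_neutral atLeastAtMost_iff
        le_add_same_cancel1 less_eq_real_def linorder_not_less order_refl pi_gt_zero zero_le_mult_iff zero_le_numeral)
  show False
  \<comment> \<open>A path in the common direction of \<open>w\<close> and \<open>v\<close> confines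
    the shifted angles of \<open>C\<close> to an interval reaching a full turn to one side of that
    direction and less than \<open>pi\<close> to the other. Points exactly a full turn apart at this
    direction do not fit.\<close>
  proof (cases "ccw_split \<C> g (g w)")
    case True
    then obtain \<mu> N where "ccw_split_at \<C> g (g w) \<mu> N" unfolding ccw_split_def by blast
    note N = ccw_split_atD[OF this]
    have "2 * pi * (- 1) < 2 * pi * of_int (N C)" using N(3)[OF C w(1)] by simp
    then have "- 1 < real_of_int (N C)" by (subst (asm) mult_less_cancel_left_pos) auto
    then have "2 * pi * 0 \<le> 2 * pi * of_int (N C)" by (intro mult_left_mono) auto
    then show False using N(2) N(4)[OF C v(1)] w(2) v(2) pi_gt_zero by linarith
  next
    case False
    then have "cw_split \<C> g (g w)" using split_exists[OF A] by blast
    then obtain \<mu> N where "ccw_split_at ((`) cnj ` \<C>) (\<lambda>w. - g (cnj w)) (- g w) \<mu> N"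
      unfolding cw_split_def ccw_split_def by blast
    note N = ccw_split_atD[OF this]
    have C': "cnj ` C \<in> (`) cnj ` \<C>" "cnj w \<in> cnj ` C" "cnj v \<in> cnj ` C" using C w v by auto
    have "- g w + 2 * pi * of_int (N (cnj ` C)) < \<mu>" using N(4)[OF C'(1,2)] by simp
    then have "2 * pi * of_int (N (cnj ` C)) < 2 * pi * 1" using N(2) pi_gt_zero by linarith
    then have "real_of_int (N (cnj ` C)) < 1" by (subst (asm) mult_less_cancel_left_pos) auto
    then have "2 * pi * of_int (N (cnj ` C)) \<le> 2 * pi * 0" by (intro mult_left_mono) auto
    then show False using N(3)[OF C'(1,3)] w(2) v(2) by simp
  qed
qed

text \<open>The two arcs cover a whole turn, from one start of \<open>C\<close> to the next. In a
  minimal family of three this is impossible, which is the source of the strict gaps between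
  arcs.\<close>

lemma blocked_of_two:
  assumes A: "arc_config \<C> g" and CD: "C \<in> \<C>" "D \<in> \<C>"
    and meet: "arc_start g D + 2 * pi * of_int j \<le> arc_end g C + 2 * pi * of_int i"
    and around: "arc_start g C + 2 * pi * of_int i + 2 * pi \<le> arc_end g D + 2 * pi * of_int j"
  shows "blocked (C \<union> D)"
  unfolding blocked_def
proof
  fix \<theta>
  define x where "x = arc_start g C + 2 * pi * of_int i"
  define m where "m = \<lfloor>(\<theta> - x) / (2 * pi)\<rfloor>"
  define t where "t = \<theta> - 2 * pi * of_int m"
  have "of_int m \<le> (\<theta> - x) / (2 * pi)" "(\<theta> - x) / (2 * pi) < of_int m + 1" unfolding m_def by linarith+
  then have t: "x \<le> t" "t < x + 2 * pi" by (simp_all add: t_def field_simps)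
  have "\<exists>w\<in>C \<union> D. \<exists>k::int. g w + 2 * pi * of_int k = t"
  proof (cases "t \<le> arc_end g C + 2 * pi * of_int i")
    case True
    then show ?thesis using arc_lift[OF A CD(1), of t "2 * pi * of_int i"] t by (auto simp: x_def)
  next
    case False
    then show ?thesis using arc_lift[OF A CD(2), of t "2 * pi * of_int j"] t meet around by (auto simp: x_def)
  qed
  then obtain w and k :: int where w: "w \<in> C \<union> D" "g w + 2 * pi * of_int k = t" by blast
  have w': "w \<noteq> 0" "w = of_real (cmod w) * cis (g w)" using arc_config_sub(4,5)[OF A] w(1) CD by blast+
  have "cis \<theta> = cis (g w)"
    unfolding cis_eq_iff by (intro exI[of _ "k + m"]) (use w(2) in \<open>simp add: t_def algebra_simps\<close>)
  then show "\<exists>t>0. of_real t * cis \<theta> \<in> C \<union> D"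
    using w w' by (intro exI[of _ "cmod w"]) auto
qed

text \<open>Distinct lifts of one component are at least a full turn apart: their order is observed
  at one endpoint \<open>y\<close> and used at another endpoint \<open>x\<close>.\<close>

lemma next_turn:
  assumes "y + 2 * pi * of_int i < y + 2 * pi * of_int j"
  shows "x + 2 * pi * of_int i + 2 * pi \<le> x + 2 * pi * of_int j"
proof -
  have "2 * pi * of_int i < 2 * pi * of_int j" using assms by simp
  then have "real_of_int i < of_int j" by (subst (asm) mult_less_cancel_left_pos) auto
  then have "i + 1 \<le> j" by simp
  then have "real_of_int i + 1 \<le> of_int j" by linarith
  then have "2 * pi * (of_int i + 1) \<le> 2 * pi * of_int j" by (intro mult_left_mono) auto
  then show ?thesis by (simp add: algebra_simps)
qed

text \<open>The cover of the circle has to continue past the end of \<open>C\<close>. It does so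
  with another component, because by \<open>arc_short\<close> the next lift of \<open>C\<close>
  starts only after this end.\<close>

lemma next_arc:
  assumes A: "arc_config \<C> g" and C: "C \<in> \<C>"
  obtains D j where "D \<in> \<C>" "D \<noteq> C" "arc_start g D + 2 * pi * of_int j \<le> arc_end g C + 2 * pi * of_int i"
    "arc_end g C + 2 * pi * of_int i < arc_end g D + 2 * pi * of_int j"
proof -
  obtain D u v j where D: "D \<in> \<C>" "u \<in> D" "v \<in> D"
    "g u + 2 * pi * of_int j \<le> arc_end g C + 2 * pi * of_int i" "arc_end g C + 2 * pi * of_int i < g v + 2 * pi * of_int j"
    using right_cover[OF A] by blast
  then have D': "arc_start g D + 2 * pi * of_int j \<le> arc_end g C + 2 * pi * of_int i"
    "arc_end g C + 2 * pi * of_int i < arc_end g D + 2 * pi * of_int j"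
    using arc_bounds[OF A D(1)] by (meson add_le_cancel_right order_trans less_le_trans)+
  have "D \<noteq> C"
  proof
    assume "D = C"
    then have "arc_end g C + 2 * pi * of_int i < arc_end g C + 2 * pi * of_int j" using D'(2) by simp
    from next_turn[OF this, of "arc_start g C"] show False using D'(1) arc_short[OF A C] unfolding \<open>D = C\<close> by linarith
  qed
  then show ?thesis using that D(1) D' by blast
qed

lemma int_mod2_cases:
  obtains t :: int where "k = 2 * t" | t where "k = 2 * t + 1"
  by (metis evenE oddE)

lemma int_mod3_cases:
  obtains t :: int where "k = 3 * t" | t where "k = 3 * t + 1" | t where "k = 3 * t + 2"
proof -
  have "k = 3 * (k div 3) \<or> k = 3 * (k div 3) + 1 \<or> k = 3 * (k div 3) + 2" by presburger
  then show ?thesis using that by blast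
qed

text \<open>With two components the gap condition compares consecutive lifts of the same component,
  which is \<open>arc_short\<close>. The integer \<open>j\<close> is the turn at which
  \<open>D\<close> follows turn 0 of \<open>C\<close>.\<close>

lemma chain_of_two:
  assumes A: "arc_config {C, D} g" and "C \<noteq> D"
    and 1: "arc_start g D + 2 * pi * of_int j \<le> arc_end g C"
    and 2: "arc_start g C + 2 * pi \<le> arc_end g D + 2 * pi * of_int j"
  shows False
proof -
  define c where "c k = (if even k then C else D)" for k :: int
  define q where "q k = (if even k then k div 2 else k div 2 + j)" for k :: int
  have cs: "c (2 * t) = C" "c (2 * t + 1) = D" "c (2 * t + 1 + 1) = C" "c (2 * t + 2) = C" "c (2 * t + 1 + 2) = D" for t
    by (auto simp: c_def)
  have qs: "q (2 * t) = t" "q (2 * t + 1) = t + j" "q (2 * t + 1 + 1) = t + 1" "q (2 * t + 2) = t + 1" "q (2 * t + 1 + 2) = t + j + 1" for t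
    unfolding q_def by presburger+
  have short: "arc_end g C < arc_start g C + 2 * pi" "arc_end g D < arc_start g D + 2 * pi"
    using arc_short[OF A] by simp_all
  interpret config_chain "{C, D}" g 2 c q
  proof
    show "arc_config {C, D} g" by (rule A)
    show "c k \<in> {C, D}" for k by (simp add: c_def)
    show "c (k + 2) = c k" for k by (simp add: c_def)
    show "q (k + 2) = q k + 1" for k by (auto simp: q_def)
    show "\<exists>k. c k = E \<and> q k = m" if "E \<in> {C, D}" for E m
    proof (cases "E = C")
      case True
      then show ?thesis using cs(1)[of m] qs(1)[of m] by blast
    next
      case False
      have "q (2 * (m - j) + 1) = m" using qs(2)[of "m - j"] by linarith
      then show ?thesis using that False cs(2)[of "m - j"] by blast
    qed
    show "arc_start g (c (k + 1)) + 2 * pi * q (k + 1) \<le> arc_end g (c k) + 2 * pi * q k" for k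
      by (cases k rule: int_mod2_cases; use 1 2 in \<open>simp only: cs qs of_int_add of_int_1 distrib_left\<close>; linarith?)
    show "arc_end g (c k) + 2 * pi * q k < arc_start g (c (k + 2)) + 2 * pi * q (k + 2)" for k
      by (cases k rule: int_mod2_cases; use short in \<open>simp only: cs qs of_int_add of_int_1 distrib_left insert_iff simp_thms\<close>; linarith?)
  qed simp
  show False by (rule chain_False)
qed

text \<open>Over one turn starting with \<open>C\<close> at turn 0, hypotheses \<open>1\<close> to
  \<open>3\<close> are the overlaps and \<open>4\<close> to \<open>6\<close> the gaps;
  \<open>i\<close> and \<open>j\<close> are the turns at which \<open>D\<close> and \<open>E\<close>
  follow.\<close>

lemma chain_of_three:
  assumes A: "arc_config {C, D, E} g"
    and 1: "arc_start g D + 2 * pi * of_int i \<le> arc_end g C"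
    and 2: "arc_start g E + 2 * pi * of_int j \<le> arc_end g D + 2 * pi * of_int i"
    and 3: "arc_start g C + 2 * pi \<le> arc_end g E + 2 * pi * of_int j"
    and 4: "arc_end g C < arc_start g E + 2 * pi * of_int j"
    and 5: "arc_end g D + 2 * pi * of_int i < arc_start g C + 2 * pi"
    and 6: "arc_end g E + 2 * pi * of_int j < arc_start g D + 2 * pi * of_int i + 2 * pi"
    and ne: "C \<noteq> D" "C \<noteq> E" "D \<noteq> E"
  shows False
proof -
  define c where "c k = (if k mod 3 = 0 then C else if k mod 3 = 1 then D else E)" for k :: int
  define q where "q k = (if k mod 3 = 0 then k div 3 else if k mod 3 = 1 then k div 3 + i else k div 3 + j)" for k :: int
  have cs: "c (3 * t) = C" "c (3 * t + 1) = D" "c (3 * t + 2) = E" 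
    "c (3 * t + 1 + 1) = E" "c (3 * t + 2 + 1) = C" "c (3 * t + 1 + 2) = C" "c (3 * t + 2 + 2) = D" for t
    unfolding c_def by (presburger | (rule if_P | rule trans[OF if_not_P if_P] | rule trans[OF if_not_P if_not_P]; presburger))+
  have qs: "q (3 * t) = t" "q (3 * t + 1) = t + i" "q (3 * t + 2) = t + j" 
    "q (3 * t + 1 + 1) = t + j" "q (3 * t + 2 + 1) = t + 1" "q (3 * t + 1 + 2) = t + 1" "q (3 * t + 2 + 2) = t + i + 1" for t
    unfolding q_def by presburger+
  interpret config_chain "{C, D, E}" g 3 c q
  proof
    show "arc_config {C, D, E} g" by (rule A)
    show "c k \<in> {C, D, E}" for k by (simp add: c_def)
    show "c (k + 3) = c k" for k by (simp add: c_def)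
    show "q (k + 3) = q k + 1" for k by (simp add: q_def)
    show "\<exists>k. c k = F \<and> q k = m" if F: "F \<in> {C, D, E}" for F m
    proof -
      consider "F = C" | "F = D" | "F = E" using F by blast
      then show ?thesis
      proof cases
        case 1
        then show ?thesis using 1 cs(1)[of m] qs(1)[of m] by blast
      next
        case 2
        have "q (3 * (m - i) + 1) = m" using qs(2)[of "m - i"] by linarith
        then show ?thesis using 2 cs(2)[of "m - i"] by blast
      next
        case 3
        have "q (3 * (m - j) + 2) = m" using qs(3)[of "m - j"] by linarith
        then show ?thesis using 3 cs(3)[of "m - j"] by blast
      qed
    qed
    show "arc_start g (c (k + 1)) + 2 * pi * q (k + 1) \<le> arc_end g (c k) + 2 * pi * q k" for k
      by (cases k rule: int_mod3_cases; use 1 2 3 in \<open>simp only: cs qs of_int_add of_int_1 distrib_left\<close>; linarith?)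
    show "arc_end g (c k) + 2 * pi * q k < arc_start g (c (k + 2)) + 2 * pi * q (k + 2)" for k
      by (cases k rule: int_mod3_cases; use 4 5 6 in \<open>simp only: cs qs of_int_add of_int_1 distrib_left insert_iff simp_thms\<close>; linarith?)
  qed simp
  show False by (rule chain_False)
qed

text \<open>Following the arcs to the right, a return to \<open>C\<close> after two steps means that
  \<open>C\<close> and \<open>D\<close> block everything, hence are the whole family. Otherwise
  there are exactly three components. The arc after \<open>E\<close> cannot belong to
  \<open>D\<close>, since no pair blocks; so the cycle closes at \<open>C\<close>, and the same fact
  gives the gaps.\<close>

lemma no_small_minimal_config:
  assumes A: "arc_config \<C> g" and card: "card \<C> \<le> 3"
    and minimal: "\<And>\<D>. \<D> \<subset> \<C> \<Longrightarrow> \<not> blocked (\<Union>\<D>)"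
  shows False
proof -
  have fin: "finite \<C>" using A unfolding arc_config_def by (elim conjE)
  have two: "\<C> = {X, Y}" if "X \<in> \<C>" "Y \<in> \<C>" "blocked (X \<union> Y)" for X Y
    using minimal[of "{X, Y}"] that by auto
  obtain C where C: "C \<in> \<C>" using direction_lift[OF A] by blast
  obtain D i where D: "D \<in> \<C>" "D \<noteq> C" and CD: "arc_start g D + 2 * pi * of_int i \<le> arc_end g C + 2 * pi * of_int 0"
    "arc_end g C + 2 * pi * of_int 0 < arc_end g D + 2 * pi * of_int i"
    using next_arc[OF A C] by blast
  obtain E j where E: "E \<in> \<C>" "E \<noteq> D" and DE: "arc_start g E + 2 * pi * of_int j \<le> arc_end g D + 2 * pi * of_int i"
    "arc_end g D + 2 * pi * of_int i < arc_end g E + 2 * pi * of_int j"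
    using next_arc[OF A D(1)] by blast
  show False
  proof (cases "E = C")
    case True
    have "arc_end g C + 2 * pi * of_int 0 < arc_end g C + 2 * pi * of_int j"
      using CD(2) DE(2) unfolding True by linarith
    from next_turn[OF this, of "arc_start g C"] have turn: "arc_start g C + 2 * pi * of_int 0 + 2 * pi \<le> arc_end g D + 2 * pi * of_int i"
      using DE(1) unfolding True by linarith
    have "\<C> = {C, D}" by (rule two[OF C D(1) blocked_of_two[OF A C D(1) CD(1) turn]])
    then show False using chain_of_two[of C D g i] A D(2) CD(1) turn by simp
  next
    case False
    have card3: "card {C, D, E} = 3" using False D E by auto
    have sub: "{C, D, E} \<subseteq> \<C>" using C D(1) E(1) by blast
    have \<C>: "\<C> = {C, D, E}" by (rule sym, rule card_seteq[OF fin sub]) (simp only: card3 card)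
    have no_two: "\<not> blocked (X \<union> Y)" if "X \<in> \<C>" "Y \<in> \<C>" for X Y
    proof
      assume "blocked (X \<union> Y)"
      then have "{C, D, E} = {X, Y}" using two[OF that] \<C> by metis
      moreover have "card {X, Y} \<le> 2" by (simp add: card_insert_if)
      ultimately have "card {C, D, E} \<le> 2" by (simp only:)
      then show False using card3 by linarith
    qed
    obtain F m where F: "F \<in> \<C>" "F \<noteq> E" and EF: "arc_start g F + 2 * pi * of_int m \<le> arc_end g E + 2 * pi * of_int j"
      "arc_end g E + 2 * pi * of_int j < arc_end g F + 2 * pi * of_int m"
      using next_arc[OF A E(1)] by blast
    have 6: "arc_end g E + 2 * pi * of_int j < arc_start g D + 2 * pi * of_int i + 2 * pi"
      using blocked_of_two[OF A D(1) E(1) DE(1)] no_two[OF D(1) E(1)] by linarith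
    have "F \<noteq> D"
    proof
      assume "F = D"
      have "arc_end g D + 2 * pi * of_int i < arc_end g D + 2 * pi * of_int m"
        using DE(2) EF(2) unfolding \<open>F = D\<close> by linarith
      from next_turn[OF this, of "arc_start g D"] show False using EF(1) 6 unfolding \<open>F = D\<close> by linarith
    qed
    then have "F = C" using F \<C> by blast
    have "arc_end g C + 2 * pi * of_int 0 < arc_end g C + 2 * pi * of_int m"
      using CD(2) DE(2) EF(2) unfolding \<open>F = C\<close> by linarith
    from next_turn[OF this, of "arc_start g C"] have 3: "arc_start g C + 2 * pi * of_int 0 + 2 * pi \<le> arc_end g E + 2 * pi * of_int j"
      using EF(1) unfolding \<open>F = C\<close> by linarith
    have 4: "arc_end g C + 2 * pi * of_int 0 < arc_start g E + 2 * pi * of_int j"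
      using blocked_of_two[OF A C E(1) _ 3] no_two[OF C E(1)] by fastforce
    have 5: "arc_end g D + 2 * pi * of_int i < arc_start g C + 2 * pi * of_int 0 + 2 * pi"
      using blocked_of_two[OF A C D(1) CD(1)] no_two[OF C D(1)] by fastforce
    show False
      by (rule chain_of_three[of C D E g i j]) (use A \<C> CD DE 3 4 5 6 D E False in auto)
  qed
qed

section \<open>The theorem\<close>

text \<open>A branch of the argument exists on all components at once, because a bent path from the
  origin to infinity avoids them. The path towards angle 0 is used, reflected if it turns
  clockwise.\<close>

lemma arc_config_exists:
  assumes fin: "finite \<C>" and sets: "\<And>C. C \<in> \<C> \<Longrightarrow> compact C \<and> connected C \<and> C \<noteq> {}" and disj: "disjoint \<C>"
    and zero: "0 \<notin> \<Union>\<C>" and K: "blocked (\<Union>\<C>)" "escapes (\<Union>\<C>)"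
    and smooth: "\<And>p. visible (\<Union>\<C>) p \<Longrightarrow> smooth_at (\<Union>\<C>) p"
  shows "\<exists>g. arc_config \<C> g"
proof -
  have "compact (\<Union>\<C>)" using fin sets by auto
  moreover obtain t where "t > 0" "of_real t * cis 0 \<in> \<Union>\<C>" using K(1) unfolding blocked_def by blast
  ultimately obtain R where R: "R > 0" "visible (\<Union>\<C>) (of_real R * cis 0)" using visible_exists zero by blast
  obtain s m where s: "0 < s" "s < 1" "cmod m = 1"
    and ray: "\<And>t. t\<ge>0 \<Longrightarrow> of_real s * (of_real R * cis 0) + of_real t * m \<notin> \<Union>\<C>"
    using K(2)[unfolded escapes_def, rule_format, OF R(2) zero_less_one] by auto
  obtain \<nu> where \<nu>: "m = cis (0 + \<nu>)" "- pi < \<nu>" "\<nu> \<le> pi" using unit_polar[OF s(3)] by blast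
  have sR: "0 < s * R" "s * R < R" using s R by auto
  have ray': "of_real (s * R) * cis 0 + of_real t * cis (0 + \<nu>) \<notin> \<Union>\<C>" if "t \<ge> 0" for t
    using ray[OF that] \<nu>(1) by (simp add: mult.assoc)
  note ne = free_ray_oblique[OF K(1) R(2) sR ray']
  define P where "P \<mu> = {complex_of_real t | t. 0 \<le> t \<and> t \<le> s * R} \<union> {of_real (s * R) + of_real t * cis \<mu> | t. 0 \<le> t}" for \<mu>
  have slit: "\<exists>G. continuous_on (- P \<mu>) G \<and> (\<forall>w. w \<notin> P \<mu> \<longrightarrow> w = of_real (cmod w) * cis (G w))"
    if "0 < \<mu>" "\<mu> < pi" for \<mu>
    by (rule slit_argument[OF sR(1) that, folded P_def]) blast
  have off: "w \<notin> P \<nu>" if "w \<in> \<Union>\<C>" for w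
  proof
    assume "w \<in> P \<nu>"
    then consider t where "0 \<le> t" "t \<le> s * R" "w = of_real t"
      | t where "0 \<le> t" "w = of_real (s * R) + of_real t * cis \<nu>" unfolding P_def by blast
    then show False
    proof cases
      case 1
      then show ?thesis using visible_segment[OF R(2), of t] sR that by simp
    next
      case 2
      then show ?thesis using ray'[OF 2(1)] that by simp
    qed
  qed
  have "\<exists>g. continuous_on (\<Union>\<C>) g \<and> (\<forall>w\<in>\<Union>\<C>. w = of_real (cmod w) * cis (g w))"
  proof (cases "\<nu> > 0")
    case True
    have "\<nu> < pi" using \<nu>(3) ne(2) by simp
    obtain G where G: "continuous_on (- P \<nu>) G" "\<And>w. w \<notin> P \<nu> \<Longrightarrow> w = of_real (cmod w) * cis (G w)"
      using slit[OF True \<open>\<nu> < pi\<close>] by blast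
    have "continuous_on (\<Union>\<C>) G" using G(1) by (rule continuous_on_subset) (use off in blast)
    then show ?thesis using G(2) off by blast
  next
    case False
    then have "0 < - \<nu>" "- \<nu> < pi" using ne(1) \<nu>(2) by auto
    then obtain G where G: "continuous_on (- P (- \<nu>)) G" "\<And>w. w \<notin> P (- \<nu>) \<Longrightarrow> w = of_real (cmod w) * cis (G w)"
      using slit by blast
    have off': "cnj w \<notin> P (- \<nu>)" if "w \<in> \<Union>\<C>" for w
    proof
      assume "cnj w \<in> P (- \<nu>)"
      then have "cnj (cnj w) \<in> cnj ` P (- \<nu>)" by (rule imageI)
      also have "cnj ` P (- \<nu>) \<subseteq> P \<nu>" unfolding P_def by (auto simp: cis_cnj)
      finally show False using off[OF that] by simp
    qed
    have "continuous_on (\<Union>\<C>) (\<lambda>w. - G (cnj w))"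
      using off' by (intro continuous_intros continuous_on_compose2[OF G(1)]) auto
    moreover have "w = of_real (cmod w) * cis (- G (cnj w))" if "w \<in> \<Union>\<C>" for w
    proof -
      have "cnj (cnj w) = cnj (of_real (cmod (cnj w)) * cis (G (cnj w)))"
        using G(2)[OF off'[OF that]] by (rule arg_cong)
      then show ?thesis by (simp add: cis_cnj)
    qed
    ultimately show ?thesis by (intro exI[of _ "\<lambda>w. - G (cnj w)"]) blast
  qed
  then obtain g where g: "continuous_on (\<Union>\<C>) g" "\<And>w. w \<in> \<Union>\<C> \<Longrightarrow> w = of_real (cmod w) * cis (g w)" by blast
  have "arc_config \<C> g" unfolding arc_config_def
  proof (intro conjI)
    show "\<forall>w\<in>\<Union>\<C>. w \<noteq> 0 \<and> w = of_real (cmod w) * cis (g w)" using g(2) zero by metis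
  qed (use fin sets disj g(1) K smooth in auto)
  then show ?thesis by blast
qed

section \<open>Identification of the plane with the complex numbers\<close>

definition vec_of :: "complex \<Rightarrow> real^2" where "vec_of z = vector [Re z, Im z]"

definition complex_of :: "real^2 \<Rightarrow> complex" where "complex_of v = Complex (v $ 1) (v $ 2)"

lemma vec_of_nth [simp]: "vec_of z $ 1 = Re z" "vec_of z $ 2 = Im z"
  by (simp_all add: vec_of_def)

lemma vec_of_complex_of [simp]: "vec_of (complex_of v) = v" "complex_of (vec_of z) = z"
  by (simp_all add: complex_of_def vec_eq_iff forall_2)

lemma linear_vec_of: "linear vec_of"
  by (intro linearI) (simp_all add: vec_eq_iff forall_2)

lemma linear_complex_of: "linear complex_of"
  by (intro linearI) (simp_all add: complex_of_def complex_eq_iff)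

lemma inner_vec_of: "v \<bullet> vec_of z = complex_of v \<bullet> z"
  by (simp add: inner_vec_def sum_2 inner_complex_def complex_of_def)

lemma norm_vec_of [simp]: "norm (vec_of z) = cmod z"
  by (simp add: norm_eq_sqrt_inner inner_vec_of)

lemma continuous_on_complex_of: "continuous_on S complex_of"
  using linear_complex_of by (simp add: linear_continuous_on linear_conv_bounded_linear)

theorem theorem6:
  fixes E :: "(real^2) set"
  assumes "closed E"
    and "bounded E"
    and "smooth_boundary E"
    and "weakly_semiconvex_closed E"
    and "\<not> semiconvex E"
  shows "infinite (components E) \<or> card (components E) \<ge> 4"
proof (rule ccontr)
  assume "\<not> ?thesis"
  then have fin: "finite (components E)" and card: "card (components E) \<le> 3" by auto
  obtain x where x: "x \<notin> E" "\<not> semiconvex_wrt E x" using assms(5) unfolding semiconvex_def by blast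
  define S where "S z = x + vec_of z" for z
  define T where "T v = complex_of (v - x)" for v
  have ST [simp]: "S (T v) = v" "T (S z) = z" for v z by (simp_all add: S_def T_def)
  have S_line: "S (u + of_real t * v) = S u + t *\<^sub>R vec_of v" for u v t
    using linear_add[OF linear_vec_of] linear_scale[OF linear_vec_of] by (simp add: S_def scaleR_conv_of_real[symmetric])
  have dist_S: "dist (S u) (S v) = dist u v" for u v
    using linear_diff[OF linear_vec_of, of u v] by (simp add: S_def dist_norm flip: norm_vec_of)
  define \<K> where "\<K> = (`) T ` components E"
  have TS: "z \<in> T ` F \<longleftrightarrow> S z \<in> F" for z F by (metis ST image_iff)
  have \<K>: "finite \<K>" "card \<K> \<le> 3" using fin card card_image_le[OF fin, of "(`) T"] unfolding \<K>_def by auto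
  have sets: "compact C \<and> connected C \<and> C \<noteq> {}" if "C \<in> \<K>" for C
  proof -
    obtain F where F: "F \<in> components E" "C = T ` F" using \<open>C \<in> \<K>\<close> unfolding \<K>_def by blast
    have "closed F" using closed_components[OF assms(1) F(1)] .
    moreover have "bounded F" using bounded_subset[OF assms(2)] in_components_subset[OF F(1)] by blast
    ultimately have "compact F" by (simp add: compact_eq_bounded_closed)
    moreover have "continuous_on F T" unfolding T_def
      by (intro continuous_on_compose2[OF continuous_on_complex_of[of UNIV]] continuous_intros) auto
    ultimately show ?thesis
      using F in_components_connected[OF F(1)] in_components_nonempty[OF F(1)]
      by (auto intro: compact_continuous_image connected_continuous_image)
  qed
  have disj: "disjoint \<K>" unfolding disjoint_def
  proof (intro ballI impI)
    fix X Y assume "X \<in> \<K>" "Y \<in> \<K>" "X \<noteq> Y"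
    then obtain F G where FG: "F \<in> components E" "G \<in> components E" "F \<noteq> G" "X = T ` F" "Y = T ` G"
      unfolding \<K>_def by blast
    then have "F \<inter> G = {}" using components_nonoverlap by blast
    then show "X \<inter> Y = {}" unfolding FG by (auto simp: TS) (metis ST(1) disjoint_iff)
  qed
  have union: "z \<in> \<Union>\<K> \<longleftrightarrow> S z \<in> E" for z
  proof -
    have "z \<in> \<Union>\<K> \<longleftrightarrow> (\<exists>F\<in>components E. S z \<in> F)" unfolding \<K>_def by (auto simp: TS)
    also have "\<dots> \<longleftrightarrow> S z \<in> E" using Union_components[of E] by blast
    finally show ?thesis .
  qed
  have "blocked (\<Union>\<K>)" unfolding blocked_def union
  proof
    fix \<theta>
    have "is_ray {x + t *\<^sub>R vec_of (cis \<theta>) | t. t \<ge> 0}"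
      unfolding is_ray_def
    proof (intro exI conjI)
      show "vec_of (cis \<theta>) \<noteq> 0" using norm_vec_of[of "cis \<theta>"] by (metis norm_cis norm_zero zero_neq_one)
    qed simp
    moreover have "x \<in> {x + t *\<^sub>R vec_of (cis \<theta>) | t. t \<ge> 0}" by (auto intro!: exI[of _ 0])
    ultimately have "{x + t *\<^sub>R vec_of (cis \<theta>) | t. t \<ge> 0} \<inter> E \<noteq> {}"
      using x(2) unfolding semiconvex_wrt_def by blast
    then obtain t where t: "t \<ge> 0" "x + t *\<^sub>R vec_of (cis \<theta>) \<in> E" by blast
    moreover have "t \<noteq> 0" using t x(1) by auto
    moreover have "S (of_real t * cis \<theta>) = x + t *\<^sub>R vec_of (cis \<theta>)"
      using S_line[of 0 t "cis \<theta>"] linear_0[OF linear_vec_of] by (simp add: S_def)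
    ultimately show "\<exists>t>0. S (of_real t * cis \<theta>) \<in> E" by (intro exI[of _ t]) auto
  qed
  \<comment> \<open>A blocking subfamily of least cardinality is also minimal under inclusion. From
    here on, visibility refers to this subfamily and not to all of \<open>E\<close>.\<close>
  then obtain \<C> where \<C>: "\<C> \<subseteq> \<K>" "blocked (\<Union>\<C>)"
    and least: "\<And>\<D>. \<D> \<subseteq> \<K> \<Longrightarrow> blocked (\<Union>\<D>) \<Longrightarrow> card \<C> \<le> card \<D>"
    using ex_has_least_nat[of "\<lambda>\<D>. \<D> \<subseteq> \<K> \<and> blocked (\<Union>\<D>)" \<K> card] by blast
  have fin\<C>: "finite \<C>" using \<C>(1) \<K>(1) finite_subset by blast
  have minimal: "\<not> blocked (\<Union>\<D>)" if "\<D> \<subset> \<C>" for \<D>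
    using least[of \<D>] psubset_card_mono[OF fin\<C> that] that \<C>(1) by auto
  have rest: "closed (\<Union>(\<K> - \<C>))" using \<K>(1) sets by (auto intro: compact_imp_closed)
  \<comment> \<open>The finitely many discarded components form a closed set, so near a point of the
    subfamily \<open>E\<close> coincides with it. This is how escaping rays and smoothness pass from
    \<open>E\<close> to the subfamily.\<close>
  have away: "\<exists>r>0. \<forall>z\<in>ball p r. S z \<in> E \<longrightarrow> z \<in> \<Union>\<C>" if pC: "p \<in> \<Union>\<C>" for p
  proof -
    have "p \<notin> \<Union>(\<K> - \<C>)"
    proof
      assume "p \<in> \<Union>(\<K> - \<C>)"
      then obtain X Y where XY: "X \<in> \<C>" "p \<in> X" "Y \<in> \<K>" "Y \<notin> \<C>" "p \<in> Y" using pC by auto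
      then have "X \<inter> Y = {}" using \<C>(1) by (intro disj[unfolded disjoint_def, rule_format]) auto
      then show False using XY by auto
    qed
    moreover have "open (- \<Union>(\<K> - \<C>))" using rest by (rule open_Compl)
    ultimately obtain r where "r > 0" "ball p r \<subseteq> - \<Union>(\<K> - \<C>)" unfolding open_contains_ball by blast
    moreover have "z \<in> \<Union>\<C> \<or> z \<in> \<Union>(\<K> - \<C>)" if "S z \<in> E" for z
      using that unfolding union[symmetric] by blast
    ultimately show ?thesis by (meson ComplD subsetD)
  qed
  have zero: "0 \<notin> \<Union>\<C>" using \<C>(1) union[of 0] x(1) linear_0[OF linear_vec_of] by (auto simp: S_def)
  have near: "\<exists>s. 0 < s \<and> 1 - \<epsilon> < s \<and> s < 1 \<and> of_real s * p \<notin> \<Union>\<C> \<and> S (of_real s * p) \<notin> E"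
    if p: "visible (\<Union>\<C>) p" and \<epsilon>: "\<epsilon> > 0" for p and \<epsilon> :: real
  proof -
    obtain r where r: "r > 0" "\<And>z. z \<in> ball p r \<Longrightarrow> S z \<in> E \<Longrightarrow> z \<in> \<Union>\<C>"
      using away p unfolding visible_def by blast
    have p0: "p \<noteq> 0" using p zero unfolding visible_def by auto
    define s where "s = 1 - min (1 / 2) (min (\<epsilon> / 2) (r / (2 * cmod p)))"
    have d: "0 < 1 - s" "1 - s \<le> 1 / 2" "1 - s \<le> \<epsilon> / 2" "1 - s \<le> r / (2 * cmod p)"
      using r \<epsilon> p0 by (auto simp: s_def)
    have "dist p (of_real s * p) = cmod (of_real (1 - s) * p)" by (simp add: dist_norm algebra_simps)
    also have "\<dots> = (1 - s) * cmod p" using d by (simp add: norm_mult del: of_real_diff)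
    also have "\<dots> \<le> r / (2 * cmod p) * cmod p" using d by (intro mult_right_mono) auto
    also have "\<dots> < r" using r p0 by simp
    finally have "of_real s * p \<in> ball p r" by simp
    moreover have "of_real s * p \<notin> \<Union>\<C>" using p d unfolding visible_def by auto
    ultimately show ?thesis using r(2) d \<epsilon> by (intro exI[of _ s]) auto
  qed
  have esc: "escapes (\<Union>\<C>)" unfolding escapes_def
  proof (intro allI impI)
    fix p and \<epsilon> :: real assume p: "visible (\<Union>\<C>) p" and "\<epsilon> > 0"
    then obtain s0 where s0: "0 < s0" "1 - \<epsilon> < s0" "s0 < 1" "S (of_real s0 * p) \<notin> E" using near by blast
    obtain A :: "nat \<Rightarrow> (real^2) set" where A: "E = (\<Inter>k. A k)" "\<And>k. weakly_semiconvex_open (A k)"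
      using assms(4) unfolding weakly_semiconvex_closed_def approximated_from_outside_def by blast
    \<comment> \<open>A point just before \<open>p\<close> is outside \<open>E\<close>, hence
      outside some \<open>A k\<close>, while \<open>p\<close> is inside. The radial segment between
      them therefore crosses the frontier of \<open>A k\<close>.\<close>
    obtain k where k: "S (of_real s0 * p) \<notin> A k" using s0(4) A(1) by blast
    have Ak: "open (A k)" "E \<subseteq> A k" using A unfolding weakly_semiconvex_open_def by auto
    have Sp: "S p \<in> A k" using p \<C>(1) union Ak(2) unfolding visible_def by blast
    define J where "J = (\<lambda>s. S (of_real s * p)) ` {s0..1}"
    have "continuous_on {s0..1} (\<lambda>s. S (of_real s * p))"
      unfolding S_def
      by (intro continuous_intros linear_continuous_on_compose[OF _ linear_vec_of])
    then have "connected J" unfolding J_def by (intro connected_continuous_image connected_Icc)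
    moreover have "S p \<in> J" unfolding J_def by (rule image_eqI[of _ _ 1]) (use s0 in auto)
    then have "J \<inter> A k \<noteq> {}" using Sp by blast
    moreover have "S (of_real s0 * p) \<in> J" unfolding J_def by (rule image_eqI[of _ _ s0]) (use s0 in auto)
    then have "J - A k \<noteq> {}" using k by blast
    ultimately have "J \<inter> frontier (A k) \<noteq> {}" by (rule connected_Int_frontier)
    then obtain s where s: "s \<in> {s0..1}" "S (of_real s * p) \<in> frontier (A k)" unfolding J_def by blast
    then have "S (of_real s * p) \<notin> A k" using Ak(1) by (simp add: frontier_def interior_open)
    then have "s \<noteq> 1" using Sp by auto
    obtain L where L: "is_ray L" "S (of_real s * p) \<in> L" "L \<inter> A k = {}"
      using A(2) s(2) unfolding weakly_semiconvex_open_def semiconvex_wrt_def by blast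
    obtain a d where d: "d \<noteq> 0" "L = {a + t *\<^sub>R d | t. t \<ge> 0}" using L(1) unfolding is_ray_def by blast
    obtain t0 where t0: "t0 \<ge> 0" "S (of_real s * p) = a + t0 *\<^sub>R d" using L(2) d(2) by blast
    \<comment> \<open>The ray through the frontier point may start elsewhere; its tail from that
      point is kept and given unit speed.\<close>
    define m where "m = complex_of ((1 / norm d) *\<^sub>R d)"
    have m: "vec_of m = (1 / norm d) *\<^sub>R d" by (simp add: m_def)
    have "cmod m = 1" using d(1) unfolding norm_vec_of[symmetric] m by simp
    moreover have "of_real s * p + of_real t * m \<notin> \<Union>\<C>" if "t \<ge> 0" for t
    proof
      assume "of_real s * p + of_real t * m \<in> \<Union>\<C>"
      then have "S (of_real s * p + of_real t * m) \<in> A k" using \<C>(1) union Ak(2) by blast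
      moreover have "S (of_real s * p + of_real t * m) = a + (t0 + t / norm d) *\<^sub>R d"
        unfolding S_line t0(2) m by (simp add: algebra_simps)
      moreover have "t0 + t / norm d \<ge> 0" using t0(1) that by simp
      ultimately show False using L(3) d(2) by blast
    qed
    ultimately show "\<exists>s m. 0 < s \<and> 1 - \<epsilon> < s \<and> s < 1 \<and> cmod m = 1 \<and> (\<forall>t\<ge>0. of_real s * p + of_real t * m \<notin> \<Union>\<C>)"
      using s s0 \<open>s \<noteq> 1\<close> by (intro exI[of _ s] exI[of _ m]) auto
  qed
  have smooth: "smooth_at (\<Union>\<C>) p" if p: "visible (\<Union>\<C>) p" for p
  proof -
    have pC: "p \<in> \<Union>\<C>" using p unfolding visible_def by blast
    \<comment> \<open>By \<open>near\<close>, points outside all of \<open>E\<close>, discarded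
      components included, accumulate at a visible point along its radial segment.\<close>
    have "S p \<notin> interior E"
    proof
      assume "S p \<in> interior E"
      then obtain e where e: "e > 0" "ball (S p) e \<subseteq> E" unfolding mem_interior by blast
      have p0: "p \<noteq> 0" using pC zero by auto
      obtain s where s: "1 - e / cmod p < s" "s < 1" "S (of_real s * p) \<notin> E" using near[OF p, of "e / cmod p"] e p0 by auto
      have "dist (S p) (S (of_real s * p)) = cmod (of_real (1 - s) * p)"
        unfolding dist_S by (simp add: dist_norm algebra_simps)
      also have "\<dots> = (1 - s) * cmod p" using s by (simp add: norm_mult del: of_real_diff)
      also have "\<dots> < e" using s(1) p0 by (simp add: field_simps)
      finally show False using e(2) s(3) by auto
    qed
    moreover have "S p \<in> E" using pC \<C>(1) union by blast
    ultimately have Spf: "S p \<in> frontier E" using closure_subset unfolding frontier_def by blast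
    obtain U and f :: "real^2 \<Rightarrow> real" and g where Ufg: "open U \<and> S p \<in> U \<and> (\<forall>y\<in>U. GDERIV f y :> g y) \<and>
      continuous_on U g \<and> (\<forall>y\<in>U. g y \<noteq> 0) \<and> frontier E \<inter> U = {y \<in> U. f y = 0}"
      using bspec[OF assms(3)[unfolded smooth_boundary_def] Spf] by (elim exE)
    then have U: "open U" "S p \<in> U" and f: "\<And>y. y \<in> U \<Longrightarrow> GDERIV f y :> g y" "\<And>y. y \<in> U \<Longrightarrow> g y \<noteq> 0"
      and zeros: "frontier E \<inter> U = {y \<in> U. f y = 0}" by simp_all
    obtain r1 where r1: "r1 > 0" "ball (S p) r1 \<subseteq> U" using U open_contains_ball by blast
    obtain r2 where r2: "r2 > 0" "\<And>z. z \<in> ball p r2 \<Longrightarrow> S z \<in> E \<Longrightarrow> z \<in> \<Union>\<C>" using away[OF pC] by blast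
    define r where "r = min r1 r2"
    have inU: "S z \<in> U" if "z \<in> ball p r" for z using that r1(2) dist_S[of p z] by (auto simp: r_def)
    have der: "(f \<circ> S has_derivative (\<lambda>v. complex_of (g (S z)) \<bullet> v)) (at z)" if "z \<in> ball p r" for z
    proof -
      have "(f has_derivative (\<lambda>h. h \<bullet> g (S z))) (at (S z))" using f(1)[OF inU[OF that]] unfolding gderiv_def .
      moreover have "(S has_derivative vec_of) (at z)"
        unfolding S_def using linear_vec_of
        by (auto intro!: derivative_eq_intros linear_imp_has_derivative)
      ultimately have "(f \<circ> S has_derivative (\<lambda>h. h \<bullet> g (S z)) \<circ> vec_of) (at z)" by (intro diff_chain_at)
      moreover have "(\<lambda>h. h \<bullet> g (S z)) \<circ> vec_of = (\<lambda>v. complex_of (g (S z)) \<bullet> v)"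
        unfolding comp_def by (rule ext) (metis inner_vec_of inner_commute)
      ultimately show ?thesis by simp
    qed
    show ?thesis unfolding smooth_at_def
    proof (intro exI conjI ballI impI)
      show "r > 0" using r1 r2 by (simp add: r_def)
      then have pr: "p \<in> ball p r" by simp
      show "continuous_on (ball p r) (f \<circ> S)"
        using der has_derivative_continuous continuous_at_imp_continuous_on by blast
      show "((f \<circ> S) has_derivative (\<lambda>v. complex_of (g (S p)) \<bullet> v)) (at p)" using der[OF pr] .
      show "complex_of (g (S p)) \<noteq> 0" using f(2)[OF U(2)] linear_0[OF linear_vec_of] vec_of_complex_of(1) by metis
      show "(f \<circ> S) p = 0" using zeros U(2) Spf by auto
      fix z assume z: "z \<in> ball p r" "(f \<circ> S) z = 0"
      then have "S z \<in> frontier E" using zeros inU by auto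
      then have "S z \<in> E" using assms(1) frontier_subset_eq by blast
      then show "z \<in> \<Union>\<C>" using r2(2) z by (simp add: r_def)
    qed
  qed
  have disj\<C>: "disjoint \<C>" using pairwise_subset[OF disj \<C>(1)] .
  have "\<exists>g. arc_config \<C> g"
    using arc_config_exists[OF fin\<C> _ disj\<C> zero \<C>(2) esc smooth] sets \<C>(1) by (meson subsetD)
  then obtain g where "arc_config \<C> g" ..
  moreover have "card \<C> \<le> 3" using card_mono[OF \<K>(1) \<C>(1)] \<K>(2) by simp
  ultimately show False using no_small_minimal_config minimal by blast
qed

end
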